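(* Let $n\ge 1$ be an integer. For all $A\subset \{0,1\}^n$ with $|A|\le \frac12$, $$\mathbf{E} \sqrt{h_A} \ge |A| \sqrt{\log_2(1/|A|)}.$$
   Context: The Hamming cube is the graph with vertex set $\{0,1\}^n$ in which two points are joined by an edge if and only if they differ in exactly one coordinate. For $f:\{0,1\}^n\to\mathbb{R}$, $\mathbf{E} f = 2^{-n}\sum_{x\in\{0,1\}^n} f(x)$. For $A\subset\{0,1\}^n$, $|A|=\mathbf{E}\mathbf{1}_A$ denotes the normalized counting measure of $A$ (not its cardinality). For $x\in A$, $h_A(x)$ is the number of edges connecting $x$ with $\{0,1\}^n\setminus A$, i.e. the number of coordinates $i$ such that flipping the $i$-th bit of $x$ gives a point outside $A$; for $x\notin A$, $h_A(x)=0$. When $|A|=0$ the right-hand side is interpreted as $0$. *)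

theory Defs
  imports Complex_Main "HOL-Library.Indicator_Function"
begin

text \<open>Points of the cube \<open>{0,1}^n\<close> are boolean lists of length \<open>n\<close>
  (\<open>False\<close> for 0, \<open>True\<close> for 1); coordinates are numbered from 0.\<close>

definition cube :: "nat \<Rightarrow> bool list set" where
  "cube n = {x. length x = n}"

definition hamming_adj :: "nat \<Rightarrow> bool list \<Rightarrow> bool list \<Rightarrow> bool" where
  "hamming_adj n x y \<longleftrightarrow> x \<in> cube n \<and> y \<in> cube n \<and> (\<exists>!i. i < n \<and> x ! i \<noteq> y ! i)"

definition cube_expectation :: "nat \<Rightarrow> (bool list \<Rightarrow> real) \<Rightarrow> real" where
  "cube_expectation n f = (\<Sum>x\<in>cube n. f x) / 2 ^ n"

definition cube_measure :: "nat \<Rightarrow> bool list set \<Rightarrow> real" where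
  "cube_measure n A = cube_expectation n (indicator A)"

text \<open>The Hamming graph is simple, so the edges joining \<open>x\<close> to the complement of \<open>A\<close>
  are counted by their endpoints outside \<open>A\<close>.\<close>

definition edge_boundary :: "nat \<Rightarrow> bool list set \<Rightarrow> bool list \<Rightarrow> nat" where
  "edge_boundary n A x = (if x \<in> A then card {y \<in> cube n - A. hamming_adj n x y} else 0)"

lemma hamming_adj_iff_flip:
  assumes "x \<in> cube n"
  shows "hamming_adj n x y \<longleftrightarrow> (\<exists>i<n. y = x[i := \<not> x ! i])"
proof
  assume "hamming_adj n x y"
  then have l: "length x = n" "length y = n" and ex: "\<exists>!i. i < n \<and> x ! i \<noteq> y ! i"
    by (simp_all only: hamming_adj_def cube_def mem_Collect_eq)
  from ex obtain i where i: "i < n \<and> x ! i \<noteq> y ! i"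
    and u: "\<forall>j. j < n \<and> x ! j \<noteq> y ! j \<longrightarrow> j = i"
    by (rule ex1E)
  have "y = x[i := \<not> x ! i]"
  proof (rule nth_equalityI)
    show "length y = length (x[i := \<not> x ! i])" using l by simp
    fix j assume j: "j < length y"
    show "y ! j = x[i := \<not> x ! i] ! j"
    proof (cases "j = i")
      case True
      have "x[i := \<not> x ! i] ! i = (\<not> x ! i)" using i l(1) by simp
      also have "\<dots> = y ! i" using i by argo
      finally show ?thesis unfolding True by (rule sym)
    next
      case False
      have "x ! j = y ! j" using u False j unfolding l(2) by blast
      then show ?thesis using False by (simp only: nth_list_update_neq)
    qed
  qed
  then show "\<exists>i<n. y = x[i := \<not> x ! i]" using i by blast
next
  assume "\<exists>i<n. y = x[i := \<not> x ! i]"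
  then obtain i where i: "i < n" "y = x[i := \<not> x ! i]" by blast
  have l: "length x = n" using assms by (simp add: cube_def)
  have "\<exists>!j. j < n \<and> x ! j \<noteq> y ! j"
  proof (rule ex1I[of _ i])
    show "i < n \<and> x ! i \<noteq> y ! i" unfolding i(2) using i(1) l by simp
    fix j assume "j < n \<and> x ! j \<noteq> y ! j"
    then show "j = i" unfolding i(2) by (metis nth_list_update_neq)
  qed
  moreover have "length y = n" unfolding i(2) using l by simp
  ultimately show "hamming_adj n x y"
    using l by (simp only: hamming_adj_def cube_def mem_Collect_eq)
qed

lemma edge_boundary_eq_card_flips:
  assumes "A \<subseteq> cube n" "x \<in> A"
  shows "edge_boundary n A x = card {i. i < n \<and> x[i := \<not> x ! i] \<notin> A}"
proof -
  have x: "x \<in> cube n" and l: "length x = n" using assms by (auto simp: cube_def)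
  have "{y \<in> cube n - A. hamming_adj n x y}
      = (\<lambda>i. x[i := \<not> x ! i]) ` {i. i < n \<and> x[i := \<not> x ! i] \<notin> A}"
    using l by (auto simp: hamming_adj_iff_flip[OF x] cube_def)
  moreover have "inj_on (\<lambda>i. x[i := \<not> x ! i]) {i. i < n \<and> x[i := \<not> x ! i] \<notin> A}"
  proof (rule inj_onI)
    fix i j assume ij: "i \<in> {i. i < n \<and> x[i := \<not> x ! i] \<notin> A}"
      and eq: "x[i := \<not> x ! i] = x[j := \<not> x ! j]"
    then have "x[i := \<not> x ! i] ! i = x[j := \<not> x ! j] ! i" by simp
    then show "i = j" using ij l by (cases "i = j") simp_all
  qed
  ultimately show ?thesis
    using assms(2) by (simp add: edge_boundary_def card_image)
qed

end

theory Submission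
  imports Defs "HOL-Analysis.Analysis"
begin

text \<open>
  Write \<open>L x = x sqrt (log 2 (1 / x))\<close>. Cut the cube along one coordinate and let \<open>x \<le> y\<close> be the measures
  of the two slices of \<open>A\<close>. A point of the larger slice gains one boundary edge exactly when it lies
  outside the smaller slice, and such points have measure at least \<open>y - x\<close>. So if a function
  \<open>B \<ge> 0\<close> with \<open>B 0 = B 1 = 0\<close> satisfies the two-point inequality
  \<open>2 B ((x + y) / 2) \<le> B x + max (sqrt ((y - x)^2 + B(y)^2)) (y - x + (sqrt 2 - 1) B y)\<close>,
  then induction on the dimension gives \<open>E sqrt h_A \<ge> B |A|\<close>
  (\<open>expectation_sqrt_boundary_ge_subsolution\<close>). It remains to find such a \<open>B\<close> that dominates \<open>L\<close>
  on \<open>[0, 1/2]\<close>.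

  For \<open>y\<close> close to \<open>x\<close> the inequality says \<open>B B'' \<ge> -2\<close>, and it excludes concave kinks. Together with
  \<open>B (1/2) = 1/2\<close> and \<open>B 1 = 0\<close> this bounds the slope of \<open>B\<close> at \<open>1/2\<close> by about \<open>0.21\<close>, whereas the slope
  of \<open>L\<close> there is about \<open>0.28\<close>. Hence \<open>B\<close> cannot be \<open>L\<close> up to \<open>1/2\<close>, and \<open>bellman\<close> has three pieces:
  \<open>L\<close> on \<open>[0, 1/4]\<close>; on \<open>[1/4, 1/2]\<close> the parabola \<open>Q\<close> that agrees with \<open>L\<close> at both ends and has
  slope \<open>31/200\<close> at \<open>1/2\<close>; and on \<open>[1/2, 1]\<close> a function \<open>J\<close> with the same slope at \<open>1/2\<close>, with
  \<open>J J'' \<ge> -2\<close>, and with \<open>J 1 = 0\<close>.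

  Equality holds in the two-point inequality on the diagonal and at \<open>(0, 2^-k)\<close>; the proof treats these
  places by exact arguments and the rest by concavity. There are four regions.

  If \<open>y \<le> 1/2\<close>, two exact mechanisms are available. The inequality for \<open>L\<close> is invariant
  under scaling by Minkowski's inequality, so only \<open>y = 1/2\<close> matters (\<open>entropy_profile_two_point\<close>). For \<open>Q\<close>
  the second difference is constant and the inequality becomes a bound on
  \<open>q Q y + q^2 (y - x)^2 / 4\<close>, where \<open>- q\<close> is the leading coefficient (\<open>mid_profile_two_point\<close>).

  If \<open>y \<ge> 1/2\<close> and \<open>x + y \<ge> 1\<close>, then for fixed \<open>x\<close> the difference of the two sides increases with \<open>y\<close>
  (\<open>cap_gap_mono\<close>); this is where \<open>J J'' \<ge> -2\<close> enters. So the inequality follows from its cases \<open>x = y\<close>, which is trivial,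
  and \<open>x + y = 1\<close>.

  If \<open>y \<ge> 1/2\<close>, \<open>x + y \<le> 1\<close> and \<open>x \<ge> 1/4\<close>, then for fixed \<open>y\<close> the inequality is a concave condition in
  \<open>(y - x)^2\<close>, so the cases \<open>x = 1/4\<close> and \<open>x + y = 1\<close> suffice (\<open>mid_cap_two_point\<close>).

  If \<open>y \<ge> 1/2\<close>, \<open>x + y \<le> 1\<close> and \<open>x \<le> 1/4\<close>, replace the maximum by a linear function
  \<open>c B y + s (y - x)\<close> below it. The difference of the two sides is then concave in \<open>x\<close> and, for the \<open>c\<close> used, in \<open>y\<close>, so on a
  rectangle it suffices to check the four corners (\<open>rectangle_two_point\<close>). Seven rectangles and an edge cover the part
  away from the equality at \<open>x = 0\<close>, and the linear term of the maximum handles the rest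
  (\<open>entropy_cap_two_point_linear\<close>).
\<close>

section \<open>Elementary inequalities\<close>

lemmas poly_simps = power2_eq_square power3_eq_cube algebra_simps add_divide_distrib diff_divide_distrib

lemma concave_on_subset:
  "concave_on T f \<Longrightarrow> S \<subseteq> T \<Longrightarrow> convex S \<Longrightarrow> concave_on S f"
  unfolding concave_on_def by (rule convex_on_subset)

text \<open>This is how all numerical cases are reduced to finitely many points: a multiple of \<open>f\<close> plus a quadratic
polynomial stays concave as long as \<open>f\<close> is concave enough to absorb the quadratic term, and then its
sign on an interval is decided at the end points.\<close>

lemma concave_on_Icc_nonneg:
  fixes f :: "real \<Rightarrow> real"
  assumes f: "concave_on {a..b} (\<lambda>x. f x + k * x\<^sup>2)"
    and x: "a \<le> x" "x \<le> b" and c: "0 \<le> c" "m \<le> c * k"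
    and a: "0 \<le> c * f a + (m * a\<^sup>2 + p * a + r)" and b: "0 \<le> c * f b + (m * b\<^sup>2 + p * b + r)"
  shows "0 \<le> c * f x + (m * x\<^sup>2 + p * x + r)"
proof (cases "a = b")
  case False
  define t where "t = (x - a) / (b - a)"
  have t: "0 \<le> t" "t \<le> 1" using x False by (simp_all add: t_def)
  have "t * (b - a) = x - a" using x False by (simp add: t_def)
  then have xt: "x = (1 - t) * a + t * b" by (simp add: algebra_simps)
  have "(1 - t) * (f a + k * a\<^sup>2) + t * (f b + k * b\<^sup>2) \<le> f x + k * x\<^sup>2"
    using concave_onD[OF f t, of a b] x t by (simp add: xt)
  moreover define P where "P = (1 - t) * (f a + k * a\<^sup>2) + t * (f b + k * b\<^sup>2)"
  ultimately have P: "c * P \<le> c * (f x + k * x\<^sup>2)" using c by (intro mult_left_mono) simp_all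
  define S where "S = (c * k - m) * (t * (1 - t) * (b - a)\<^sup>2)"
  have S: "0 \<le> S" unfolding S_def using c t by (intro mult_nonneg_nonneg) simp_all
  define R where "R = (1 - t) * (c * f a + (m * a\<^sup>2 + p * a + r)) + t * (c * f b + (m * b\<^sup>2 + p * b + r))"
  have R: "0 \<le> R" unfolding R_def using t a b by simp
  have "c * P - c * (k * x\<^sup>2) - R + (m * x\<^sup>2 + p * x + r) = S"
    unfolding xt P_def R_def S_def by (simp add: power2_eq_square) algebra
  then show ?thesis using P R S by (simp add: distrib_left)
qed (use x a in simp)

text \<open>Cauchy--Schwarz; for a unit vector the left-hand side is a tangent plane of the cone on the right.\<close>

lemma cos_sin_le_hypot:
  fixes c s b d :: real
  assumes "c\<^sup>2 + s\<^sup>2 \<le> 1"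
  shows "c * b + s * d \<le> sqrt (d\<^sup>2 + b\<^sup>2)"
proof (rule real_le_rsqrt)
  have "(c * b + s * d)\<^sup>2 = (c\<^sup>2 + s\<^sup>2) * (d\<^sup>2 + b\<^sup>2) - (c * d - s * b)\<^sup>2"
    by (simp add: power2_eq_square algebra_simps)
  also have "\<dots> \<le> (c\<^sup>2 + s\<^sup>2) * (d\<^sup>2 + b\<^sup>2)" by simp
  also have "\<dots> \<le> 1 * (d\<^sup>2 + b\<^sup>2)" using assms by (intro mult_right_mono) simp_all
  finally show "(c * b + s * d)\<^sup>2 \<le> d\<^sup>2 + b\<^sup>2" by simp
qed

text \<open>Needed at the junction of the two formulas for the profile of large sets.\<close>

lemma has_real_derivative_glue:
  fixes f g h :: "real \<Rightarrow> real"
  assumes g: "(g has_real_derivative D) (at c)" and h: "(h has_real_derivative D) (at c)"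
    and fg: "\<And>x. x \<le> c \<Longrightarrow> f x = g x" and fh: "\<And>x. c \<le> x \<Longrightarrow> f x = h x"
  shows "(f has_real_derivative D) (at c)"
proof -
  have "(f has_real_derivative D) (at c within {..c})"
    using has_field_derivative_at_within[OF g, of "{..c}"] unfolding has_field_derivative_def
    by (rule has_derivative_transform[rotated 2]) (auto simp: fg)
  moreover have "(f has_real_derivative D) (at c within {c..})"
    using has_field_derivative_at_within[OF h, of "{c..}"] unfolding has_field_derivative_def
    by (rule has_derivative_transform[rotated 2]) (auto simp: fh)
  ultimately have "(f has_real_derivative D) (at c within {..c} \<union> {c..})"
    unfolding has_field_derivative_iff by (simp add: at_within_union filterlim_sup)
  moreover have "{..c} \<union> {c..} = UNIV" by auto
  ultimately show ?thesis by simp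
qed

lemma sqrt2_bounds: "141421 / 100000 < sqrt 2" "sqrt 2 < 141422 / 100000"
  by (rule real_less_rsqrt, simp add: power2_eq_square) (rule real_less_lsqrt, simp_all add: power2_eq_square)

lemma sqrt3_bounds: "173205 / 100000 < sqrt 3" "sqrt 3 < 173206 / 100000"
  by (rule real_less_rsqrt, simp add: power2_eq_square) (rule real_less_lsqrt, simp_all add: power2_eq_square)

section \<open>Induction on the dimension\<close>

definition slice :: "bool \<Rightarrow> bool list set \<Rightarrow> bool list set" where
  "slice b A = {x. b # x \<in> A}"

lemma slice_subset_cube: "A \<subseteq> cube (Suc n) \<Longrightarrow> slice b A \<subseteq> cube n"
  by (auto simp: slice_def cube_def)

lemma cube_0: "cube 0 = {[]}"
  by (auto simp: cube_def)

lemma cube_Suc: "cube (Suc n) = Cons False ` cube n \<union> Cons True ` cube n"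
proof
  show "cube (Suc n) \<subseteq> Cons False ` cube n \<union> Cons True ` cube n"
  proof
    fix x assume "x \<in> cube (Suc n)"
    then obtain b y where "x = b # y" "y \<in> cube n"
      by (auto simp: cube_def length_Suc_conv)
    then show "x \<in> Cons False ` cube n \<union> Cons True ` cube n" by (cases b) auto
  qed
qed (auto simp: cube_def)

lemma finite_cube: "finite (cube n)"
  by (induction n) (simp_all add: cube_0 cube_Suc)

lemma card_cube: "card (cube n) = 2 ^ n"
proof (induction n)
  case (Suc n)
  have "Cons False ` cube n \<inter> Cons True ` cube n = {}" by auto
  then show ?case
    using Suc by (simp add: cube_Suc card_Un_disjoint finite_cube card_image)
qed (simp add: cube_0)

lemma cube_expectation_Suc:
  "cube_expectation (Suc n) f
     = (cube_expectation n (\<lambda>x. f (b # x)) + cube_expectation n (\<lambda>x. f ((\<not> b) # x))) / 2"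
proof -
  have disj: "Cons False ` cube n \<inter> Cons True ` cube n = {}" by auto
  have "sum f (cube (Suc n)) = (\<Sum>x\<in>cube n. f (False # x)) + (\<Sum>x\<in>cube n. f (True # x))"
    unfolding cube_Suc using finite_cube disj
    by (subst sum.union_disjoint) (simp_all add: sum.reindex)
  then show ?thesis
    by (cases b) (simp_all add: cube_expectation_def field_simps)
qed

lemma cube_expectation_mono:
  assumes "\<And>x. x \<in> cube n \<Longrightarrow> f x \<le> g x"
  shows "cube_expectation n f \<le> cube_expectation n g"
  unfolding cube_expectation_def by (intro divide_right_mono sum_mono assms) simp_all

lemma cube_expectation_linear:
  "cube_expectation n (\<lambda>x. a * f x + b * g x) = a * cube_expectation n f + b * cube_expectation n g"
  by (simp add: cube_expectation_def sum.distrib sum_distrib_left add_divide_distrib)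

lemma cube_measure_Suc:
  "cube_measure (Suc n) A = (cube_measure n (slice b A) + cube_measure n (slice (\<not> b) A)) / 2"
proof -
  have "indicator A (c # x) = (indicator (slice c A) x :: real)" for c x
    by (simp add: slice_def indicator_def)
  then show ?thesis
    unfolding cube_measure_def cube_expectation_Suc[of n _ b] by simp
qed

lemma cube_measure_nonneg: "0 \<le> cube_measure n A"
  by (simp add: cube_measure_def cube_expectation_def sum_nonneg)

lemma cube_measure_le_1: "cube_measure n A \<le> 1"
proof -
  have "cube_measure n A \<le> cube_expectation n (\<lambda>x. 1)"
    unfolding cube_measure_def by (intro cube_expectation_mono) (simp add: indicator_def)
  also have "\<dots> = 1" by (simp add: cube_expectation_def card_cube)
  finally show ?thesis .
qed

lemma cube_measure_diff_ge: "cube_measure n S - cube_measure n T \<le> cube_measure n (S - T)"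
proof -
  have "cube_expectation n (\<lambda>x. 1 * indicator S x + (-1) * indicator T x)
      \<le> cube_expectation n (indicator (S - T))"
    by (intro cube_expectation_mono) (simp add: indicator_def)
  then show ?thesis
    unfolding cube_measure_def cube_expectation_linear by simp
qed

text \<open>Flipping one of the remaining coordinates stays in the slice; flipping the first one moves to the same point of the other
slice.\<close>

lemma edge_boundary_Cons:
  assumes A: "A \<subseteq> cube (Suc n)"
  shows "edge_boundary (Suc n) A (b # x)
    = edge_boundary n (slice b A) x + indicator (slice b A - slice (\<not> b) A) x"
proof (cases "b # x \<in> A")
  case True
  let ?F = "{i. i < n \<and> x[i := \<not> x ! i] \<notin> slice b A}"
  have "{i. i < Suc n \<and> (b # x)[i := \<not> (b # x) ! i] \<notin> A}
      = Suc ` ?F \<union> (if x \<in> slice (\<not> b) A then {} else {0})" (is "?L = ?R")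
  proof (rule set_eqI)
    fix i show "i \<in> ?L \<longleftrightarrow> i \<in> ?R"
      by (cases i) (auto simp: slice_def)
  qed
  moreover have "card ?R = card ?F + (if x \<in> slice (\<not> b) A then 0 else 1)"
    by (auto simp: card_image card_insert_if)
  moreover have "x \<in> slice b A" using True by (simp add: slice_def)
  ultimately show ?thesis
    using True edge_boundary_eq_card_flips[OF A True]
      edge_boundary_eq_card_flips[OF slice_subset_cube[OF A] \<open>x \<in> slice b A\<close>]
    by (simp add: indicator_def)
next
  case False
  then show ?thesis by (simp add: edge_boundary_def slice_def indicator_def)
qed

text \<open>The chord of \<open>sqrt (1 + t^2)\<close> between \<open>t = 0\<close> and \<open>t = 1\<close>, as a function of \<open>t = sqrt h\<close>; it lies below the curve
outside the interval \<open>(0, 1)\<close>, which contains no square root of an integer. After averaging it improves on Cauchy--Schwarz where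
\<open>0 < B y < y - x\<close>.\<close>

lemma sqrt_nat_add_1_ge: "1 + (sqrt 2 - 1) * sqrt (real h) \<le> sqrt (real h + 1)"
proof (cases h)
  case (Suc m)
  let ?t = "sqrt (real h)" and ?k = "sqrt 2 - 1"
  have t: "?t \<ge> 1" "?t\<^sup>2 = real h" using Suc by simp_all
  have k: "?k \<ge> 0" "?k\<^sup>2 = 1 - 2 * ?k" "?k \<le> 1" by (simp_all add: power2_eq_square algebra_simps real_le_lsqrt)
  have "(1 + ?k * ?t)\<^sup>2 = 1 + ?t\<^sup>2 - 2 * ?k * ?t * (?t - 1) - (1 - ?k\<^sup>2 - 2 * ?k) * ?t\<^sup>2"
    by (simp add: power2_eq_square algebra_simps)
  also have "\<dots> \<le> 1 + ?t\<^sup>2" using k t by (simp del: real_sqrt_pow2)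
  finally show ?thesis using t by (intro real_le_rsqrt) simp
qed simp

lemma sqrt_add_sq_ge_linear:
  fixes c s h e :: real
  assumes "c\<^sup>2 + s\<^sup>2 \<le> 1" "0 \<le> h"
  shows "c * sqrt h + s * e \<le> sqrt (h + e\<^sup>2)"
  using cos_sin_le_hypot[OF assms(1), of "sqrt h" e] assms(2) by (simp add: add.commute)

text \<open>The two terms of the maximum are the lower bounds for the larger slice, of measure \<open>y\<close>, that follow from
Cauchy--Schwarz and from the integrality of the boundary counts.\<close>

definition two_point_subsolution :: "(real \<Rightarrow> real) \<Rightarrow> bool" where
  "two_point_subsolution B \<longleftrightarrow> (\<forall>x y. 0 \<le> x \<longrightarrow> x \<le> y \<longrightarrow> y \<le> 1 \<longrightarrow>
     2 * B ((x + y) / 2) \<le> B x + max (sqrt ((y - x)\<^sup>2 + (B y)\<^sup>2)) (y - x + (sqrt 2 - 1) * B y))"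

text \<open>The smaller slice contributes at least \<open>B x\<close> by induction. For the larger slice \<open>Y\<close> every pointwise bound
\<open>c sqrt h + s 1_D \<le> sqrt (h + 1_D)\<close>, with \<open>D\<close> the part of \<open>Y\<close> outside the smaller slice, may be averaged; the best unit vector
\<open>(c, s)\<close> is parallel to \<open>(B y, y - x)\<close>.\<close>

theorem expectation_sqrt_boundary_ge_subsolution:
  fixes B :: "real \<Rightarrow> real"
  assumes B: "two_point_subsolution B" "B 0 = 0" "B 1 = 0" "\<And>x. 0 \<le> x \<Longrightarrow> x \<le> 1 \<Longrightarrow> 0 \<le> B x"
    and "A \<subseteq> cube n"
  shows "B (cube_measure n A) \<le> cube_expectation n (\<lambda>x. sqrt (real (edge_boundary n A x)))"
  using \<open>A \<subseteq> cube n\<close>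
proof (induction n arbitrary: A)
  case 0
  then have "cube_measure 0 A = 0 \<or> cube_measure 0 A = 1"
    by (auto simp: cube_measure_def cube_expectation_def cube_0 indicator_def)
  then have "B (cube_measure 0 A) = 0" using B by auto
  then show ?case by (simp add: cube_expectation_def sum_nonneg)
next
  case (Suc n)
  define E where "E S = cube_expectation n (\<lambda>x. sqrt (real (edge_boundary n S x)))" for S
  have "\<exists>b. cube_measure n (slice b A) \<le> cube_measure n (slice (\<not> b) A)"
    using linear[of "cube_measure n (slice True A)" "cube_measure n (slice False A)"]
    by (auto intro: exI[of _ True] exI[of _ False])
  then obtain b where le: "cube_measure n (slice b A) \<le> cube_measure n (slice (\<not> b) A)" ..
  define X Y where "X = slice b A" and "Y = slice (\<not> b) A"
  define x y where "x = cube_measure n X" and "y = cube_measure n Y"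
  have IH: "B x \<le> E X" "B y \<le> E Y"
    unfolding x_def y_def E_def X_def Y_def by (intro Suc.IH slice_subset_cube Suc.prems)+
  have xy: "0 \<le> x" "x \<le> y" "y \<le> 1"
    using le by (simp_all add: x_def y_def X_def Y_def cube_measure_nonneg cube_measure_le_1)
  have By: "0 \<le> B y" using B(4) xy by simp
  define U where "U = cube_expectation n (\<lambda>v. sqrt (real (edge_boundary n Y v) + (indicator (Y - X) v)\<^sup>2))"
  have lower: "c * B y + s * (y - x) \<le> U"
    if "0 \<le> c" "0 \<le> s"
      and *: "\<And>v. c * sqrt (real (edge_boundary n Y v)) + s * indicator (Y - X) v
        \<le> sqrt (real (edge_boundary n Y v) + (indicator (Y - X) v)\<^sup>2)" for c s
  proof -
    have "c * B y + s * (y - x) \<le> c * E Y + s * cube_measure n (Y - X)"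
      using that(1,2) IH cube_measure_diff_ge[of n Y X]
      by (intro add_mono mult_left_mono) (simp_all add: x_def y_def)
    also have "\<dots> \<le> U"
      unfolding U_def E_def cube_measure_def cube_expectation_linear[symmetric]
      by (intro cube_expectation_mono *)
    finally show ?thesis .
  qed
  \<comment> \<open>the unit vector parallel to \<open>(B y, y - x)\<close> gives the Euclidean bound\<close>
  define r where "r = sqrt ((y - x)\<^sup>2 + (B y)\<^sup>2)"
  have "r \<le> U"
  proof (cases "r = 0")
    case True
    then show ?thesis unfolding U_def cube_expectation_def by (auto intro!: divide_nonneg_pos sum_nonneg)
  next
    case False
    then have r: "r > 0" "r * r = (y - x)\<^sup>2 + (B y)\<^sup>2" unfolding r_def by (simp_all add: order_less_le)
    have "(B y / r)\<^sup>2 + ((y - x) / r)\<^sup>2 = ((y - x)\<^sup>2 + (B y)\<^sup>2) / (r * r)"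
      by (simp add: power_divide power2_eq_square add_divide_distrib)
    then have "(B y / r)\<^sup>2 + ((y - x) / r)\<^sup>2 \<le> 1" unfolding r(2)[symmetric] using r(1) by simp
    then have "B y / r * B y + (y - x) / r * (y - x) \<le> U"
      using r By xy by (intro lower sqrt_add_sq_ge_linear) simp_all
    moreover have "B y / r * B y + (y - x) / r * (y - x) = ((y - x)\<^sup>2 + (B y)\<^sup>2) / r"
      by (simp add: power2_eq_square add_divide_distrib)
    then have "B y / r * B y + (y - x) / r * (y - x) = r" unfolding r(2)[symmetric] using r(1) by simp
    ultimately show ?thesis by simp
  qed
  moreover have "(sqrt 2 - 1) * B y + 1 * (y - x) \<le> U"
  proof (rule lower)
    fix v
    show "(sqrt 2 - 1) * sqrt (real (edge_boundary n Y v)) + 1 * indicator (Y - X) v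
        \<le> sqrt (real (edge_boundary n Y v) + (indicator (Y - X) v)\<^sup>2)"
    proof (cases "v \<in> Y - X")
      case True
      then show ?thesis using sqrt_nat_add_1_ge[of "edge_boundary n Y v"] by simp
    next
      case False
      have "(sqrt 2 - 1) * sqrt (real (edge_boundary n Y v)) \<le> 1 * sqrt (real (edge_boundary n Y v))"
        by (intro mult_right_mono) (simp_all add: real_le_lsqrt)
      then show ?thesis using False by simp
    qed
  qed simp_all
  ultimately have U: "max (sqrt ((y - x)\<^sup>2 + (B y)\<^sup>2)) (y - x + (sqrt 2 - 1) * B y) \<le> U"
    by (simp add: r_def)
  have real_indicator: "real (indicator S v) = (indicator S v)\<^sup>2" for S and v :: "bool list"
    by (simp add: indicator_def)
  have "E X \<le> cube_expectation n (\<lambda>v. sqrt (real (edge_boundary (Suc n) A (b # v))))"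
    unfolding E_def X_def by (intro cube_expectation_mono) (simp add: edge_boundary_Cons[OF Suc.prems])
  moreover have "U = cube_expectation n (\<lambda>v. sqrt (real (edge_boundary (Suc n) A ((\<not> b) # v))))"
    unfolding U_def X_def Y_def by (simp add: edge_boundary_Cons[OF Suc.prems] real_indicator)
  ultimately have "(B x + U) / 2 \<le> cube_expectation (Suc n) (\<lambda>x. sqrt (real (edge_boundary (Suc n) A x)))"
    using IH unfolding cube_expectation_Suc[of n _ b] by simp
  moreover have "2 * B ((x + y) / 2) \<le> B x + U"
    using B(1) xy U unfolding two_point_subsolution_def by (smt (verit))
  ultimately show ?case
    unfolding cube_measure_Suc[of n A b] x_def y_def X_def Y_def by simp
qed

section \<open>The profile of subcubes\<close>

definition entropy_profile :: "real \<Rightarrow> real" where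
  "entropy_profile x = x * sqrt (log 2 (1 / x))"

lemma entropy_profile_0 [simp]: "entropy_profile 0 = 0"
  by (simp add: entropy_profile_def)

lemma log_inverse_conv: "0 < x \<Longrightarrow> log 2 (1 / x) = - ln x / ln (2::real)"
  by (simp add: log_def ln_div)

lemma entropy_profile_half_power: "entropy_profile ((1 / 2) ^ k) = (1 / 2) ^ k * sqrt (real k)"
  by (simp add: entropy_profile_def log_inverse_conv ln_realpow ln_div power_divide)

lemma entropy_profile_values:
  "entropy_profile (1 / 2) = 1 / 2" "entropy_profile (1 / 4) = sqrt 2 / 4"
  "entropy_profile (1 / 8) = sqrt 3 / 8" "entropy_profile (1 / 16) = 1 / 8"
  using entropy_profile_half_power[of 1] entropy_profile_half_power[of 2]
    entropy_profile_half_power[of 3] entropy_profile_half_power[of 4]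
  by (simp_all add: power_divide)

lemma entropy_profile_nonneg: "0 \<le> x \<Longrightarrow> x \<le> 1 \<Longrightarrow> 0 \<le> entropy_profile x"
  by (cases "x = 0") (simp_all add: entropy_profile_def)

lemma entropy_profile_ge_linear:
  assumes "0 \<le> x" "x \<le> y" "y \<le> 1"
  shows "sqrt (log 2 (1 / y)) * x \<le> entropy_profile x"
proof (cases "x = 0")
  case False
  then have "log 2 (1 / y) \<le> log 2 (1 / x)" using assms by (simp add: frac_le)
  then show ?thesis using assms by (simp add: entropy_profile_def mult.commute mult_left_mono)
qed simp

lemma inverse_ln2_bounds: "36 / 25 \<le> 1 / ln (2::real)" "1 / ln (2::real) \<le> 3 / 2"
  using ln2_ge_two_thirds ln2_le_25_over_36 by (simp_all add: field_simps)

text \<open>The tangent of the logarithm at \<open>1/4\<close> suffices. The point is that \<open>L x \<le> sqrt 2 / 4\<close> below \<open>1/4\<close>,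
which makes \<open>L\<close> strongly concave there.\<close>

lemma small_log_bound:
  fixes x :: real
  assumes "0 < x" "x \<le> 1 / 4"
  shows "x * log 2 (1 / x) \<le> 1 / 2"
proof -
  \<comment> \<open>the constant \<open>4\<close> makes the tangent exact at \<open>x = 1/4\<close>\<close>
  have "ln (1 / (4 * x)) \<le> 1 / (4 * x) - 1" using assms by (intro ln_le_minus_one) simp
  moreover have "ln (1 / (4 * x)) = - ln x - 2 * ln 2"
    using assms ln_realpow[of 2 2] by (simp add: ln_div ln_mult)
  ultimately have "x * (- ln x - 2 * ln 2) \<le> x * (1 / (4 * x) - 1)"
    using assms by (intro mult_left_mono) simp_all
  also have "x * (1 / (4 * x) - 1) = 1 / 4 - x" using assms by (simp add: algebra_simps)
  finally have "- x * ln x \<le> 2 * x * ln 2 + (1 / 4 - x)" by (simp add: algebra_simps)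
  also have "\<dots> \<le> 2 * x * ln 2 + (1 / 4 - x) * (3 / 2 * ln 2)"
    using ln2_ge_two_thirds assms mult_left_mono[of 1 "3 / 2 * ln 2" "1 / 4 - x"] by simp
  also have "\<dots> = (3 / 8 + x / 2) * ln 2" by (simp add: field_simps)
  also have "\<dots> \<le> 1 / 2 * ln 2" using assms by (intro mult_right_mono) simp_all
  finally have "- x * ln x / ln 2 \<le> 1 / 2" by (subst pos_divide_le_eq) simp_all
  then show ?thesis using assms by (simp add: log_inverse_conv)
qed

lemma log_inverse_has_derivative:
  "0 < x \<Longrightarrow> ((\<lambda>x. log 2 (1 / x)) has_real_derivative - (1 / (x * ln 2))) (at x)"
  by (auto intro!: derivative_eq_intros simp: log_def field_simps power2_eq_square)

lemma entropy_profile_has_derivatives: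
  fixes x :: real
  assumes "0 < x" "x < 1"
  defines "l \<equiv> log 2 (1 / x)" and "k \<equiv> 1 / (2 * ln 2)"
  shows "(entropy_profile has_real_derivative sqrt l - k / sqrt l) (at x)"
    and "((\<lambda>x. sqrt (log 2 (1 / x)) - k / sqrt (log 2 (1 / x))) has_real_derivative
      - (k / (x * sqrt l)) * (1 + k / l)) (at x)"
proof -
  have l: "l > 0" using assms by (simp add: l_def)
  note dl = log_inverse_has_derivative[OF assms(1)]
  have ds: "((\<lambda>x. sqrt (log 2 (1 / x))) has_real_derivative - (k / (x * sqrt l))) (at x)"
    by (rule DERIV_cong[OF DERIV_chain2[OF DERIV_real_sqrt dl]])
      (use l assms(1) in \<open>simp_all add: l_def k_def field_simps\<close>)
  show "(entropy_profile has_real_derivative sqrt l - k / sqrt l) (at x)"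
    unfolding entropy_profile_def[abs_def]
    by (rule DERIV_cong[OF DERIV_mult[OF DERIV_ident ds]]) (use assms(1) in \<open>simp add: l_def\<close>)
  show "((\<lambda>x. sqrt (log 2 (1 / x)) - k / sqrt (log 2 (1 / x))) has_real_derivative
      - (k / (x * sqrt l)) * (1 + k / l)) (at x)"
  proof -
    have "((\<lambda>x. sqrt (log 2 (1 / x)) - k / sqrt (log 2 (1 / x))) has_real_derivative
      - (k / (x * sqrt l)) - (0 * sqrt l - k * - (k / (x * sqrt l))) / (sqrt l * sqrt l)) (at x)"
      by (rule DERIV_diff[OF ds DERIV_divide[OF DERIV_const ds, folded l_def]]) (use l in simp)
    moreover have "- (k / (x * sqrt l)) - (0 * sqrt l - k * - (k / (x * sqrt l))) / (sqrt l * sqrt l)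
        = - (k / (x * sqrt l)) * (1 + k / l)"
      using l assms(1) by (simp add: field_simps)
    ultimately show ?thesis by metis
  qed
qed

text \<open>With \<open>l = log 2 (1/x)\<close> and \<open>k = 1 / (2 ln 2)\<close> one has \<open>L'' = - (k / L) (1 + k / l) \<le> - k / L\<close>. The quadratic
term leaves room for the parabola that is subtracted from \<open>L\<close> in the two-point inequality:
\<open>mid_curv / 2 < 7/8\<close>.\<close>

lemma entropy_profile_concave: "concave_on {0<..1/4} (\<lambda>x. entropy_profile x + 7 / 8 * x\<^sup>2)"
proof (rule f''_le0_imp_concave)
  fix x :: real assume x: "x \<in> {0<..1/4}"
  define l k where "l = log 2 (1 / x)" and "k = 1 / (2 * ln (2::real))"
  have l: "l > 0" using x by (simp add: l_def)
  have k: "k \<ge> 18 / 25" using inverse_ln2_bounds by (simp add: k_def)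
  note D = entropy_profile_has_derivatives[of x, folded k_def l_def]
  show "((\<lambda>x. entropy_profile x + 7 / 8 * x\<^sup>2) has_real_derivative
      (\<lambda>x. sqrt (log 2 (1 / x)) - k / sqrt (log 2 (1 / x)) + 7 / 4 * x) x) (at x)"
    using x by (auto intro!: derivative_eq_intros D(1) simp: l_def)
  show "((\<lambda>x. sqrt (log 2 (1 / x)) - k / sqrt (log 2 (1 / x)) + 7 / 4 * x) has_real_derivative
      - (k / (x * sqrt l)) * (1 + k / l) + 7 / 4) (at x)"
    by (rule DERIV_add[OF D(2) DERIV_cmult_Id]) (use x in simp_all)
  have "x * (x * l) \<le> 1 / 4 * (1 / 2)"
    using x small_log_bound[of x] l by (intro mult_mono) (simp_all add: l_def)
  then have "(x * sqrt l)\<^sup>2 \<le> (9 / 25)\<^sup>2"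
    using l by (simp add: power_mult_distrib) (simp add: power2_eq_square)
  then have "x * sqrt l \<le> 9 / 25" by (rule power2_le_imp_le) simp
  moreover have pos: "0 < x * sqrt l" using x l by simp
  ultimately have "7 / 4 \<le> k / (x * sqrt l)"
    using k by (simp add: pos_le_divide_eq)
  moreover have "k / (x * sqrt l) \<le> (k / (x * sqrt l)) * (1 + k / l)"
    using pos k l mult_left_mono[of 1 "1 + k / l" "k / (x * sqrt l)"] by simp
  ultimately show "- (k / (x * sqrt l)) * (1 + k / l) + 7 / 4 \<le> 0"
    by (simp only: mult_minus_left)
qed simp

text \<open>At \<open>0\<close> the second derivative is not available. After division by \<open>x\<close> the claim compares
\<open>sqrt (log 2 (1/x))\<close> with its value at \<open>y\<close>, which follows from \<open>ln t \<le> t - 1\<close>.\<close>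

lemma entropy_profile_chord_0:
  assumes "0 \<le> x" "x \<le> y" "y \<le> 1 / 4" "0 < y"
  shows "x / y * (entropy_profile y + 7 / 8 * y\<^sup>2) \<le> entropy_profile x + 7 / 8 * x\<^sup>2"
proof (cases "x = 0")
  case False
  define g h where "g = sqrt (log 2 (1 / x))" and "h = sqrt (log 2 (1 / y))"
  have g: "g\<^sup>2 = log 2 (1 / x)" "g \<ge> 0" and h: "h\<^sup>2 = log 2 (1 / y)" "h \<ge> 0"
    using assms False by (simp_all add: g_def h_def)
  have "ln (x / y) \<le> x / y - 1" using assms False by (intro ln_le_minus_one) simp
  then have "(1 - x / y) / ln 2 \<le> g\<^sup>2 - h\<^sup>2"
    unfolding g h using assms False
    by (simp add: log_inverse_conv ln_div diff_divide_distrib[symmetric] add_divide_distrib[symmetric] divide_right_mono)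
  moreover have "1 \<le> 1 / ln (2::real)" using inverse_ln2_bounds by linarith
  then have "(1 - x / y) * 1 \<le> (1 - x / y) * (1 / ln 2)"
    by (rule mult_left_mono) (use assms in simp)
  ultimately have gh: "1 - x / y \<le> g\<^sup>2 - h\<^sup>2" by simp
  have "(y - x) * (7 / 8) \<le> g - h"
  proof (rule ccontr)
    assume "\<not> ?thesis"
    then have lt: "g < h + (y - x) * (7 / 8)" by argo
    have square: "(h + d * (7 / 8))\<^sup>2 = h\<^sup>2 + d * (7 / 4 * h + d * (49 / 64))" for d :: real
      by (simp add: power2_eq_square field_simps)
    from lt have "g\<^sup>2 < (h + (y - x) * (7 / 8))\<^sup>2" using g by (intro power_strict_mono) simp_all
    then have "g\<^sup>2 - h\<^sup>2 < (y - x) * (7 / 4 * h + (y - x) * (49 / 64))"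
      unfolding square[of "y - x"] by simp
    then have "1 - x / y < (y - x) * (7 / 4 * h + (y - x) * (49 / 64))" using gh by simp
    then have "(1 - x / y) * y < (y - x) * (7 / 4 * h + (y - x) * (49 / 64)) * y"
      using assms by (intro mult_strict_right_mono) simp_all
    then have "(y - x) * 1 < (y - x) * ((7 / 4 * h + (y - x) * (49 / 64)) * y)"
      using assms by (simp add: algebra_simps)
    then have 1: "1 < (7 / 4 * h + (y - x) * (49 / 64)) * y"
      using assms by (metis diff_ge_0_iff_ge mult_left_mono not_le)
    have "y * (y * log 2 (1 / y)) \<le> 1 / 4 * (1 / 2)"
      using assms small_log_bound[of y] by (intro mult_mono) simp_all
    then have "(h * y)\<^sup>2 \<le> (9 / 25)\<^sup>2"
      using h by (simp add: power_mult_distrib) (simp add: power2_eq_square mult.assoc mult.commute)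
    then have "h * y \<le> 9 / 25" by (rule power2_le_imp_le) simp
    moreover have "(y - x) * y \<le> 1 / 4 * (1 / 4)" using assms by (intro mult_mono) simp_all
    moreover have "(7 / 4 * h + (y - x) * (49 / 64)) * y = 7 / 4 * (h * y) + 49 / 64 * ((y - x) * y)"
      by (simp add: algebra_simps)
    ultimately show False using 1 by linarith
  qed
  then have "x * (h + 7 / 8 * y) \<le> x * (g + 7 / 8 * x)"
    using assms by (intro mult_left_mono) (simp_all add: field_simps)
  moreover have "x / y * (entropy_profile y + 7 / 8 * y\<^sup>2) = x * (h + 7 / 8 * y)"
    using assms(4) by (simp add: entropy_profile_def h_def power2_eq_square field_simps)
  moreover have "entropy_profile x + 7 / 8 * x\<^sup>2 = x * (g + 7 / 8 * x)"
    by (simp add: entropy_profile_def g_def power2_eq_square algebra_simps)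
  ultimately show ?thesis by simp
qed simp

text \<open>The extension to the left end point, from which \<open>linear_two_point_interpolate\<close> starts.\<close>

lemma entropy_profile_concave_closed: "concave_on {0..1/4} (\<lambda>x. entropy_profile x + 7 / 8 * x\<^sup>2)"
proof (rule concave_on_linorderI)
  fix t x y :: real
  assume t: "0 < t" "t < 1" and xy: "x \<in> {0..1/4}" "y \<in> {0..1/4}" "x < y"
  let ?f = "\<lambda>x. entropy_profile x + 7 / 8 * x\<^sup>2"
  show "(1 - t) * ?f x + t * ?f y \<le> ?f ((1 - t) *\<^sub>R x + t *\<^sub>R y)"
  proof (cases "x = 0")
    case True
    have "t * y / y * ?f y \<le> ?f (t * y)"
      using t xy True by (intro entropy_profile_chord_0) (simp_all add: mult_le_cancel_right2)
    then show ?thesis using True xy by simp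
  next
    case False
    then show ?thesis
      using concave_onD[OF entropy_profile_concave, of t x y] t xy by simp
  qed
qed simp

lemma entropy_profile_concave_Icc:
  "0 \<le> a \<Longrightarrow> b \<le> 1 / 4 \<Longrightarrow> concave_on {a..b} (\<lambda>x. entropy_profile x + 7 / 8 * x\<^sup>2)"
  by (rule concave_on_subset[OF entropy_profile_concave_closed]) auto

lemma entropy_profile_3_16: "29137 / 100000 \<le> entropy_profile (3 / 16)"
proof -
  \<comment> \<open>\<open>317 / 200\<close> approximates \<open>log 2 3\<close> from above\<close>
  have "(3::real) ^ 200 \<le> 2 ^ 317" by simp
  then have "ln ((3::real) ^ 200) \<le> ln (2 ^ 317)" by (subst ln_le_cancel_iff) simp_all
  moreover have "ln ((3::real) ^ 200) = real 200 * ln 3" "ln ((2::real) ^ 317) = real 317 * ln 2"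
    by (simp_all only: ln_realpow zero_less_numeral)
  ultimately have "200 * ln 3 \<le> 317 * ln (2::real)" by (simp only: of_nat_numeral)
  moreover have "ln (3 / 16 :: real) = ln 3 - 4 * ln 2"
    using ln_realpow[of 2 4] by (simp add: ln_div)
  ultimately have "483 / 200 \<le> log 2 (1 / (3 / 16 :: real))"
    by (subst log_inverse_conv) (simp_all add: pos_le_divide_eq)
  then have "sqrt (483 / 200) \<le> sqrt (log 2 (1 / (3 / 16 :: real)))" by (rule real_sqrt_le_mono)
  moreover have "29137 * 16 / 300000 \<le> sqrt (483 / 200)"
    by (rule real_le_rsqrt) (simp add: power2_eq_square)
  ultimately show ?thesis unfolding entropy_profile_def by linarith
qed

section \<open>A parabola above the profile of subcubes\<close>

text \<open>Minus the leading coefficient, chosen so that the parabola below takes the value \<open>sqrt 2 / 4\<close> at \<open>1/4\<close>.\<close>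

definition mid_curv :: real where "mid_curv = 369 / 50 - 4 * sqrt 2"

definition mid_profile :: "real \<Rightarrow> real" where
  "mid_profile x = 1 / 2 - 31 / 200 * (1 / 2 - x) - mid_curv * (1 / 2 - x)\<^sup>2"

lemma mid_curv_bounds: "17231 / 10000 < mid_curv" "mid_curv < 17232 / 10000"
  using sqrt2_bounds by (simp_all add: mid_curv_def)

lemma mid_profile_values: "mid_profile (1 / 2) = 1 / 2" "mid_profile (1 / 4) = sqrt 2 / 4"
  by (simp_all add: mid_profile_def mid_curv_def power2_eq_square field_simps)

text \<open>The form in which the parabola enters the two-point inequality: a quadratic polynomial in \<open>1 - x - y\<close>.\<close>

lemma mid_profile_double:
  "2 * mid_profile ((x + y) / 2) = 1 - 31 / 200 * (1 - x - y) - mid_curv / 2 * (1 - x - y)\<^sup>2"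
  by (simp add: mid_profile_def power2_eq_square field_simps)

text \<open>For every \<open>c > 0\<close>, \<open>sqrt l \<le> l / (2 c) + c / 2\<close> replaces \<open>L\<close> by the simpler function
\<open>x l / (2 c) + c x / 2\<close>, with equality where \<open>l = c^2\<close>. The choices \<open>c = sqrt 2\<close> and \<open>c = 1\<close> are exact at
\<open>1/4\<close> and \<open>1/2\<close>, the two points where the curves meet; in both cases the difference to the parabola is concave,
so that only \<open>3/8\<close> has to be checked in addition.\<close>

lemma entropy_profile_le_mid_profile:
  assumes "1 / 4 \<le> x" "x \<le> 1 / 2"
  shows "entropy_profile x \<le> mid_profile x"
proof -
  define e where "e x = x * log 2 (1 / x)" for x :: real
  have amgm: "entropy_profile x \<le> e x / (2 * c) + c * x / 2" if "0 < c" for c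
  proof -
    define r where "r = sqrt (log 2 (1 / x))"
    have r: "r\<^sup>2 = log 2 (1 / x)" using assms by (simp add: r_def)
    have "0 \<le> x * (r - c)\<^sup>2" using assms by simp
    then have "2 * c * (x * r) \<le> x * r\<^sup>2 + c\<^sup>2 * x" by (simp add: power2_eq_square algebra_simps)
    then have "x * r \<le> (x * r\<^sup>2 + c\<^sup>2 * x) / (2 * c)" using that by (simp add: pos_le_divide_eq algebra_simps)
    also have "\<dots> = x * r\<^sup>2 / (2 * c) + c * x / 2" using that by (simp add: field_simps power2_eq_square)
    finally show ?thesis by (simp add: entropy_profile_def e_def r r_def[symmetric])
  qed
  have conc: "concave_on {1/4..1/2} (\<lambda>x. - e x + (- 3) * x\<^sup>2)"
  proof (rule f''_le0_imp_concave)
    fix x :: real assume x: "x \<in> {1/4..1/2}"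
    show "((\<lambda>x. - e x + - 3 * x\<^sup>2) has_real_derivative (\<lambda>x. 1 / ln 2 - log 2 (1 / x) - 6 * x) x) (at x)"
      unfolding e_def using x
      by (auto intro!: derivative_eq_intros log_inverse_has_derivative)
    show "((\<lambda>x. 1 / ln 2 - log 2 (1 / x) - 6 * x) has_real_derivative 1 / (x * ln 2) - 6) (at x)"
      using x by (auto intro!: derivative_eq_intros log_inverse_has_derivative)
    have "1 / x * (1 / ln 2) \<le> 4 * (3 / 2)"
      using x inverse_ln2_bounds by (intro mult_mono) (simp_all add: field_simps)
    then show "1 / (x * ln 2) - 6 \<le> 0" by simp
  qed simp
  have e_values: "e (1 / 2) = 1 / 2" "e (1 / 4) = 1 / 2" "e (3 / 8) \<le> 532 / 1000"
  proof -
    show "e (1 / 2) = 1 / 2" by (simp add: e_def)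
    show "e (1 / 4) = 1 / 2" using log_pow_cancel[of 2 2] by (simp add: e_def)
    \<comment> \<open>\<open>19 / 12\<close> approximates \<open>log 2 3\<close> from below\<close>
    have "(2::real) ^ 19 \<le> 3 ^ 12" by simp
    then have "ln ((2::real) ^ 19) \<le> ln (3 ^ 12)" by (subst ln_le_cancel_iff) simp_all
    moreover have "ln ((2::real) ^ 19) = real 19 * ln 2" "ln ((3::real) ^ 12) = real 12 * ln 3"
      by (simp_all only: ln_realpow zero_less_numeral)
    ultimately have "19 * ln 2 \<le> 12 * ln (3::real)" by (simp only: of_nat_numeral)
    moreover have "ln (3 / 8 :: real) = ln 3 - 3 * ln 2"
      using ln_realpow[of 2 3] by (simp add: ln_div)
    ultimately have "log 2 (1 / (3 / 8 :: real)) \<le> 17 / 12"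
      by (subst log_inverse_conv) (simp_all add: pos_divide_le_eq)
    then show "e (3 / 8) \<le> 532 / 1000" unfolding e_def by simp
  qed
  have sq: "(\<lambda>x. - 1 * e x + - 3 * x\<^sup>2) = (\<lambda>x. - e x + - 3 * x\<^sup>2)" by simp
  define q where "q = mid_curv"
  have mp: "mid_profile y = - q * y\<^sup>2 + (31 / 200 + q) * y + (1 / 2 - 31 / 400 - q / 4)" for y
    by (simp add: mid_profile_def q_def power2_eq_square field_simps)
  show ?thesis
  proof (cases "x \<le> 3 / 8")
    case True
    have 0: "concave_on {1/4..3/8} (\<lambda>x. - e x + (- 3) * x\<^sup>2)"
      using conc by (rule concave_on_subset) auto
    have r: "1 / (2 * sqrt 2) = sqrt 2 / 4" by (simp add: field_simps)
    have "0 \<le> 1 / (2 * sqrt 2) * - e x + (- q * x\<^sup>2 + (31 / 200 + q - sqrt 2 / 2) * x + (1 / 2 - 31 / 400 - q / 4))"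
    proof (rule concave_on_Icc_nonneg[OF 0])
      show "- q \<le> 1 / (2 * sqrt 2) * - 3"
        unfolding r using mid_curv_bounds sqrt2_bounds by (simp add: q_def)
      show "0 \<le> 1 / (2 * sqrt 2) * - e (1 / 4) + (- q * (1 / 4)\<^sup>2 + (31 / 200 + q - sqrt 2 / 2) * (1 / 4) + (1 / 2 - 31 / 400 - q / 4))"
        by (simp add: e_values q_def mid_curv_def power2_eq_square field_simps)
      have "1 / (2 * sqrt 2) * e (3 / 8) \<le> sqrt 2 / 4 * (532 / 1000)"
        unfolding r by (rule mult_left_mono[OF e_values(3)]) simp
      moreover have "sqrt 2 / 4 * (532 / 1000) \<le> - q * (3 / 8)\<^sup>2 + (31 / 200 + q - sqrt 2 / 2) * (3 / 8) + (1 / 2 - 31 / 400 - q / 4)"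
        using sqrt2_bounds
        by (simp add: q_def mid_curv_def power2_eq_square algebra_simps add_divide_distrib diff_divide_distrib)
      ultimately show "0 \<le> 1 / (2 * sqrt 2) * - e (3 / 8) + (- q * (3 / 8)\<^sup>2 + (31 / 200 + q - sqrt 2 / 2) * (3 / 8) + (1 / 2 - 31 / 400 - q / 4))"
        unfolding mult_minus_right by linarith
    qed (use assms True in auto)
    then show ?thesis using amgm[of "sqrt 2"] unfolding mp by (simp add: algebra_simps)
  next
    case False
    have 0: "concave_on {3/8..1/2} (\<lambda>x. - e x + (- 3) * x\<^sup>2)"
      using conc by (rule concave_on_subset) auto
    have "0 \<le> 1 / 2 * - e x + (- q * x\<^sup>2 + (31 / 200 + q - 1 / 2) * x + (1 / 2 - 31 / 400 - q / 4))"
    proof (rule concave_on_Icc_nonneg[OF 0])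
      show "- q \<le> 1 / 2 * - 3" using mid_curv_bounds by (simp add: q_def)
      show "0 \<le> 1 / 2 * - e (1 / 2) + (- q * (1 / 2)\<^sup>2 + (31 / 200 + q - 1 / 2) * (1 / 2) + (1 / 2 - 31 / 400 - q / 4))"
        by (simp add: e_values power2_eq_square field_simps)
      show "0 \<le> 1 / 2 * - e (3 / 8) + (- q * (3 / 8)\<^sup>2 + (31 / 200 + q - 1 / 2) * (3 / 8) + (1 / 2 - 31 / 400 - q / 4))"
        using e_values(3) mid_curv_bounds by (simp add: q_def power2_eq_square field_simps)
    qed (use assms False in auto)
    then show ?thesis using amgm[of 1] unfolding mp by (simp add: algebra_simps)
  qed
qed

text \<open>Below \<open>1/4\<close> the parabola passes under \<open>L\<close>: compare its tangents with chords of the concave function \<open>L\<close>.\<close>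

lemma mid_profile_le_entropy_profile:
  assumes "1 / 8 \<le> x" "x \<le> 1 / 4"
  shows "mid_profile x \<le> entropy_profile x"
proof -
  define q where "q = mid_curv"
  have q: "17231 / 10000 < q" "q < 17232 / 10000" using mid_curv_bounds by (simp_all add: q_def)
  have tangent: "mid_profile x \<le> mid_profile y + (31 / 200 + 2 * q * (1 / 2 - y)) * (x - y)" for y
  proof -
    have "0 \<le> q * (x - y)\<^sup>2" using q by simp
    then show ?thesis by (simp add: mid_profile_def q_def[symmetric] power2_eq_square field_simps)
  qed
  have conc: "concave_on {u..v} (\<lambda>x. entropy_profile x + 7 / 8 * x\<^sup>2)" if "1 / 8 \<le> u" "v \<le> 1 / 4" for u v
    by (rule concave_on_subset[OF entropy_profile_concave]) (use that in auto)
  have m316: "mid_profile (3 / 16) \<le> 2834 / 10000"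
    using q by (simp add: mid_profile_def q_def[symmetric] power2_eq_square)
  show ?thesis
  proof (cases "x \<le> 3 / 16")
    case True
    have "0 \<le> 1 * entropy_profile x + (0 * x\<^sup>2 + - (123 / 100) * x + (123 / 100 * (3 / 16) - 2834 / 10000))"
    proof (rule concave_on_Icc_nonneg[OF conc])
      show "0 \<le> 1 * entropy_profile (1 / 8) + (0 * (1 / 8)\<^sup>2 + - (123 / 100) * (1 / 8) + (123 / 100 * (3 / 16) - 2834 / 10000))"
        using sqrt3_bounds by (simp add: entropy_profile_values)
      show "0 \<le> 1 * entropy_profile (3 / 16) + (0 * (3 / 16)\<^sup>2 + - (123 / 100) * (3 / 16) + (123 / 100 * (3 / 16) - 2834 / 10000))"
        using entropy_profile_3_16 by simp
    qed (use assms True in auto)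
    moreover have "(31 / 200 + 2 * q * (1 / 2 - 3 / 16)) * (x - 3 / 16) \<le> 123 / 100 * (x - 3 / 16)"
      using q True by (intro mult_right_mono_neg) simp_all
    ultimately show ?thesis using tangent[of "3 / 16"] m316 by simp
  next
    case False
    have "0 \<le> 1 * entropy_profile x + (0 * x\<^sup>2 + - 1 * x + (1 / 4 - sqrt 2 / 4))"
    proof (rule concave_on_Icc_nonneg[OF conc])
      show "0 \<le> 1 * entropy_profile (3 / 16) + (0 * (3 / 16)\<^sup>2 + - 1 * (3 / 16) + (1 / 4 - sqrt 2 / 4))"
        using entropy_profile_3_16 sqrt2_bounds by simp
      show "0 \<le> 1 * entropy_profile (1 / 4) + (0 * (1 / 4)\<^sup>2 + - 1 * (1 / 4) + (1 / 4 - sqrt 2 / 4))"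
        by (simp add: entropy_profile_values)
    qed (use assms False in auto)
    moreover have "(31 / 200 + 2 * q * (1 / 2 - 1 / 4)) * (x - 1 / 4) \<le> 1 * (x - 1 / 4)"
      using q assms by (intro mult_right_mono_neg) simp_all
    ultimately show ?thesis using tangent[of "1 / 4"] mid_profile_values by simp
  qed
qed

section \<open>The two-point inequality below one half\<close>

text \<open>For a parabola \<open>2 Q z = Q x + Q y + q d^2 / 2\<close> with \<open>d = y - x\<close>, so the claim is
\<open>(Q y + q d^2 / 2)^2 \<le> d^2 + (Q y)^2\<close>, that is, \<open>q Q y + q^2 d^2 / 4 \<le> 1\<close>.\<close>

lemma mid_profile_two_point:
  assumes "x \<le> y" "y - x \<le> 3 / 8" "y \<le> 1 / 2"
  shows "2 * mid_profile ((x + y) / 2) \<le> mid_profile x + sqrt ((y - x)\<^sup>2 + (mid_profile y)\<^sup>2)"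
proof -
  define q m d where "q = mid_curv" and "m = mid_profile y" and "d = y - x"
  have q: "17231 / 10000 < q" "q < 17232 / 10000" using mid_curv_bounds by (simp_all add: q_def)
  have eq: "2 * mid_profile ((x + y) / 2) = mid_profile x + (m + q * d\<^sup>2 / 2)"
    by (simp add: mid_profile_def m_def d_def q_def power2_eq_square field_simps)
  have "0 \<le> q * (1 / 2 - y)\<^sup>2" using q by simp
  moreover have "0 \<le> 31 / 200 * (1 / 2 - y)" using assms by simp
  ultimately have "m \<le> 1 / 2" unfolding m_def mid_profile_def q_def by linarith
  then have "q * m \<le> q * (1 / 2)" using q by (intro mult_left_mono) simp_all
  then have "q * m \<le> 8616 / 10000" using q by linarith
  moreover have "q * q * (d * d) \<le> 17232 / 10000 * (17232 / 10000) * (3 / 8 * (3 / 8))"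
    using q assms by (intro mult_mono) (simp_all add: d_def)
  ultimately have "q * m + q * q * (d * d) / 4 \<le> 1" by linarith
  then have "(q * m + q * q * (d * d) / 4) * d\<^sup>2 \<le> 1 * d\<^sup>2"
    by (intro mult_right_mono) simp_all
  then have "(m + q * d\<^sup>2 / 2)\<^sup>2 \<le> d\<^sup>2 + m\<^sup>2"
    by (simp add: power2_eq_square field_simps)
  then have "m + q * d\<^sup>2 / 2 \<le> sqrt (d\<^sup>2 + m\<^sup>2)" by (rule real_le_rsqrt)
  then show ?thesis unfolding eq by (simp add: m_def d_def)
qed

text \<open>Here the equality case \<open>(x, y) = (0, 1/2)\<close> is a corner of the region. There \<open>d = Q y\<close>, so the square
root may be replaced by its tangent plane \<open>(d + Q y) / sqrt 2\<close>, and \<open>L x \<ge> sqrt 3 x\<close> has a large enough slope to make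
the remaining linear function of \<open>x\<close> and \<open>1/2 - y\<close> nonnegative.\<close>

lemma mid_profile_two_point_small:
  assumes "0 \<le> x" "x \<le> 1 / 8" "y \<le> 1 / 2" "1 / 2 \<le> x + y"
  shows "2 * mid_profile ((x + y) / 2) \<le> entropy_profile x + sqrt ((y - x)\<^sup>2 + (mid_profile y)\<^sup>2)"
proof -
  define q m d e where "q = mid_curv" and "m = mid_profile y" and "d = y - x" and "e = 1 / 2 - y"
  have q: "17231 / 10000 < q" "q < 17232 / 10000" using mid_curv_bounds by (simp_all add: q_def)
  have e: "0 \<le> e" "e \<le> x" "e \<le> 1 / 8" using assms by (simp_all add: e_def)
  have "log 2 (1 / (1 / 8 :: real)) = 3" using log_pow_cancel[of 2 3] by simp
  then have L: "sqrt 3 * x \<le> entropy_profile x"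
    using entropy_profile_ge_linear[of x "1 / 8"] assms by simp
  have "(sqrt 2 / 2 * d + sqrt 2 / 2 * m)\<^sup>2 + (sqrt 2 / 2 * d - sqrt 2 / 2 * m)\<^sup>2 = d\<^sup>2 + m\<^sup>2"
    by (simp add: power2_eq_square algebra_simps)
  moreover have "0 \<le> (sqrt 2 / 2 * d - sqrt 2 / 2 * m)\<^sup>2" by simp
  ultimately have "(sqrt 2 / 2 * d + sqrt 2 / 2 * m)\<^sup>2 \<le> d\<^sup>2 + m\<^sup>2" by linarith
  then have rho: "sqrt 2 / 2 * d + sqrt 2 / 2 * m \<le> sqrt (d\<^sup>2 + m\<^sup>2)" by (rule real_le_rsqrt)
  have qe: "q * (e * e) \<le> 17232 / 10000 * (1 / 8 * e)"
    using q e by (intro mult_mono) simp_all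
  have dm: "d = 1 / 2 - e - x" "m = 1 / 2 - 31 / 200 * e - q * (e * e)"
    by (simp_all add: d_def m_def e_def q_def mid_profile_def power2_eq_square)
  have "1 - x - 13704 / 10000 * e \<le> d + m" using qe e unfolding dm by linarith
  then have "sqrt 2 / 2 * (1 - x - 13704 / 10000 * e) \<le> sqrt 2 / 2 * (d + m)"
    by (intro mult_left_mono) simp_all
  then have 1: "sqrt 2 / 2 - sqrt 2 / 2 * (x + 13704 / 10000 * e) \<le> sqrt (d\<^sup>2 + m\<^sup>2)"
    using rho by (simp add: algebra_simps)
  have "sqrt 2 / 2 * (x + 13704 / 10000 * e) \<le> 70711 / 100000 * (x + 13704 / 10000 * e)"
    using sqrt2_bounds assms e by (intro mult_right_mono) simp_all
  moreover have "70711 / 100000 * (x + 13704 / 10000 * e) \<le> 70711 / 100000 * x + 9691 / 10000 * e"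
    using e by (simp add: distrib_left)
  ultimately have 2: "sqrt 2 / 2 - 70711 / 100000 * x - 9691 / 10000 * e \<le> sqrt (d\<^sup>2 + m\<^sup>2)"
    using 1 by linarith
  have "0 \<le> q * (x - e)\<^sup>2" using q by simp
  then have "2 * mid_profile ((x + y) / 2) \<le> 1 - 31 / 200 * (1 / 2 + e - x) - q / 2 * (1 / 4 + e - x)"
    by (simp add: mid_profile_def q_def[symmetric] e_def power2_eq_square field_simps)
  also have "\<dots> = sqrt 2 / 2 + (31 / 200 + q / 2) * (x - e)"
    by (simp add: q_def mid_curv_def field_simps)
  also have "\<dots> \<le> 10166 / 10000 * (x - e) + sqrt 2 / 2"
    using q e mult_right_mono[of "31 / 200 + q / 2" "10166 / 10000" "x - e"] by simp
  also have "\<dots> = 10166 / 10000 * x - 10166 / 10000 * e + sqrt 2 / 2" by (simp add: right_diff_distrib)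
  finally have 3: "2 * mid_profile ((x + y) / 2) \<le> 10166 / 10000 * x - 10166 / 10000 * e + sqrt 2 / 2" .
  have "173205 / 100000 * x \<le> sqrt 3 * x"
    using sqrt3_bounds assms by (intro mult_right_mono) simp_all
  then have "173205 / 100000 * x \<le> entropy_profile x" using L by (rule order_trans)
  then show ?thesis using 2 3 e(1) assms(1) unfolding m_def d_def by linarith
qed

text \<open>In the Taylor comparison below the first-order terms cancel identically in \<open>1 / ln 2\<close>; this upper bound serves the
terms of second order.\<close>

lemma inverse_ln2_sharp: "1 / ln (2::real) \<le> 14433 / 10000"
proof -
  have "6929 / 10000 \<le> ln (2::real)"
    using ln_approx_bounds[of 2 3, simplified, simplified eval_nat_numeral, simplified] by simp
  then show ?thesis by (simp add: pos_divide_le_eq)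
qed

lemma ln_one_minus_bounds:
  fixes t :: real
  assumes "0 \<le> t" "t < 1"
  shows "t + t\<^sup>2 / 2 \<le> - ln (1 - t)"
    and "t \<le> 1 / 4 \<Longrightarrow> - ln (1 - t) \<le> t + t\<^sup>2 / 2 + 4 / 9 * t ^ 3"
proof -
  have "- ln (1 - 0) - 0 - 0\<^sup>2 / 2 \<le> - ln (1 - t) - t - t\<^sup>2 / 2"
  proof (rule DERIV_nonneg_imp_nondecreasing[of 0 t "\<lambda>t. - ln (1 - t) - t - t\<^sup>2 / 2"])
    fix s :: real assume s: "0 \<le> s" "s \<le> t"
    then have "((\<lambda>t. - ln (1 - t) - t - t\<^sup>2 / 2) has_real_derivative 1 / (1 - s) - 1 - s) (at s)"
      using assms by (auto intro!: derivative_eq_intros)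
    moreover have "1 / (1 - s) - 1 - s = s * s / (1 - s)" using s assms by (simp add: field_simps)
    ultimately have "((\<lambda>t. - ln (1 - t) - t - t\<^sup>2 / 2) has_real_derivative s * s / (1 - s)) (at s)" by simp
    then show "\<exists>y. ((\<lambda>t. - ln (1 - t) - t - t\<^sup>2 / 2) has_real_derivative y) (at s) \<and> 0 \<le> y"
      using s assms by auto
  qed (use assms in simp)
  then show "t + t\<^sup>2 / 2 \<le> - ln (1 - t)" by simp
  assume t4: "t \<le> 1 / 4"
  have "0 + 0\<^sup>2 / 2 + 4 / 9 * 0 ^ 3 + ln (1 - 0) \<le> t + t\<^sup>2 / 2 + 4 / 9 * t ^ 3 + ln (1 - t)"
  proof (rule DERIV_nonneg_imp_nondecreasing[of 0 t "\<lambda>t. t + t\<^sup>2 / 2 + 4 / 9 * t ^ 3 + ln (1 - t)"])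
    fix s :: real assume s: "0 \<le> s" "s \<le> t"
    then have "((\<lambda>t. t + t\<^sup>2 / 2 + 4 / 9 * t ^ 3 + ln (1 - t)) has_real_derivative
        1 + s + 4 / 3 * s\<^sup>2 - 1 / (1 - s)) (at s)"
      using assms by (auto intro!: derivative_eq_intros simp: power2_eq_square)
    moreover have "1 + s + 4 / 3 * s\<^sup>2 - 1 / (1 - s) = s * s * (1 - 4 * s) / (3 * (1 - s))"
      using s assms by (simp add: field_simps power2_eq_square)
    moreover have "0 \<le> s * s * (1 - 4 * s) / (3 * (1 - s))"
      using s assms t4 by (intro divide_nonneg_nonneg mult_nonneg_nonneg) simp_all
    ultimately show "\<exists>y. ((\<lambda>t. t + t\<^sup>2 / 2 + 4 / 9 * t ^ 3 + ln (1 - t)) has_real_derivative y) (at s) \<and> 0 \<le> y"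
      by auto
  qed (use assms in simp)
  then show "- ln (1 - t) \<le> t + t\<^sup>2 / 2 + 4 / 9 * t ^ 3" by simp
qed

lemma sqrt_one_plus_lower:
  fixes h :: real
  assumes "0 \<le> h" "h \<le> 4"
  shows "1 + h / 2 - h\<^sup>2 / 8 \<le> sqrt (1 + h)"
proof (rule real_le_rsqrt)
  have "0 \<le> h ^ 3 * (8 - h)" using assms by simp
  then show "(1 + h / 2 - h\<^sup>2 / 8)\<^sup>2 \<le> 1 + h"
    by (simp add: power2_eq_square power3_eq_cube field_simps)
qed

lemma sqrt_one_plus_upper:
  fixes g :: real
  assumes "0 \<le> g" "g \<le> 11 / 25"
  shows "sqrt (1 + g) \<le> 1 + g / 2 - 39 / 400 * g\<^sup>2"
proof (rule real_le_lsqrt)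
  have g2: "g * g \<le> 11 / 25 * g" using assms by (intro mult_right_mono) simp_all
  then show "0 \<le> 1 + g / 2 - 39 / 400 * g\<^sup>2" using assms by (simp add: power2_eq_square)
  have "0 \<le> g * g * (1 / 4 - 39 / 200 - 39 / 400 * g)" using assms by (intro mult_nonneg_nonneg) simp_all
  moreover have "0 \<le> (39 / 400 * (g * g))\<^sup>2" by simp
  ultimately show "1 + g \<le> (1 + g / 2 - 39 / 400 * g\<^sup>2)\<^sup>2"
    by (simp add: power2_eq_square field_simps)
qed

text \<open>Up to \<open>1/4\<close> the parabola replaces \<open>L\<close> at the midpoint. Beyond, the inequality degenerates to second order at
\<open>x = 1/2\<close>; with \<open>x = (1 - w) / 2\<close> all square roots are expanded around \<open>w = 0\<close>, the terms of order \<open>1\<close> and \<open>w\<close> cancel,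
and the coefficient of \<open>w^2\<close> is positive.\<close>

lemma entropy_profile_two_point_half:
  assumes "0 \<le> x" "x \<le> 1 / 2"
  shows "2 * entropy_profile ((x + 1 / 2) / 2) \<le> entropy_profile x + sqrt ((1 / 2 - x)\<^sup>2 + (1 / 2)\<^sup>2)"
proof (cases "x \<le> 1 / 4")
  case True
  have "entropy_profile ((x + 1 / 2) / 2) \<le> mid_profile ((x + 1 / 2) / 2)"
    using assms by (intro entropy_profile_le_mid_profile) simp_all
  moreover have "2 * mid_profile ((x + 1 / 2) / 2) \<le> entropy_profile x + sqrt ((1 / 2 - x)\<^sup>2 + (1 / 2)\<^sup>2)"
  proof (cases "x \<le> 1 / 8")
    case True
    then show ?thesis using mid_profile_two_point_small[of x "1 / 2"] assms
      by (simp add: mid_profile_values)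
  next
    case False
    then show ?thesis using mid_profile_two_point[of x "1 / 2"] mid_profile_le_entropy_profile[of x] True
      by (simp add: mid_profile_values)
  qed
  ultimately show ?thesis by linarith
next
  case False
  define w k where "w = 1 - 2 * x" and "k = 1 / ln (2::real)"
  have w: "0 \<le> w" "w < 1 / 2" and x: "x = (1 - w) / 2" using assms False by (simp_all add: w_def)
  have k: "36 / 25 \<le> k" "k \<le> 14433 / 10000" using inverse_ln2_bounds inverse_ln2_sharp by (simp_all add: k_def)
  have L: "entropy_profile ((1 - t) / 2) = (1 - t) / 2 * sqrt (1 + k * - ln (1 - t))" if "t < 1" for t
    using that unfolding entropy_profile_def by (subst log_inverse_conv) (simp_all add: ln_div k_def field_simps)
  define h where "h = k * (w + w\<^sup>2 / 2)"
  define g where "g = k * (w / 2 + (w / 2)\<^sup>2 / 2 + 4 / 9 * (w / 2) ^ 3)"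
  have "w\<^sup>2 \<le> (1 / 2)\<^sup>2" "w ^ 3 \<le> (1 / 2) ^ 3" using w by (intro power_mono; simp)+
  then have w_pow: "w\<^sup>2 \<le> 1 / 4" "w ^ 3 \<le> 1 / 8" by (simp_all add: power2_eq_square power3_eq_cube)
  have h: "0 \<le> h" "h \<le> 2 * 1"
    unfolding h_def using k w w_pow by (simp, intro mult_mono) simp_all
  have "g \<le> 14433 / 10000 * (29 / 100)"
    unfolding g_def using k w w_pow by (intro mult_mono) (simp_all add: power_divide)
  then have "g \<le> 11 / 25" by linarith
  moreover have "0 \<le> g" using w k by (simp add: g_def)
  ultimately have g: "0 \<le> g" "g \<le> 11 / 25" by simp_all
  have "h \<le> k * - ln (1 - w)"
    unfolding h_def using ln_one_minus_bounds(1)[of w] w k by (intro mult_left_mono) simp_all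
  then have "sqrt (1 + h) \<le> sqrt (1 + k * - ln (1 - w))" by simp
  then have 1: "1 + h / 2 - h\<^sup>2 / 8 \<le> sqrt (1 + k * - ln (1 - w))"
    using sqrt_one_plus_lower[of h] h by linarith
  have "k * - ln (1 - w / 2) \<le> g"
    unfolding g_def using ln_one_minus_bounds(2)[of "w / 2"] w k by (intro mult_left_mono) simp_all
  then have "sqrt (1 + k * - ln (1 - w / 2)) \<le> sqrt (1 + g)" by simp
  then have 2: "sqrt (1 + k * - ln (1 - w / 2)) \<le> 1 + g / 2 - 39 / 400 * g\<^sup>2"
    using sqrt_one_plus_upper[OF g] by linarith
  have 3: "1 + w\<^sup>2 / 2 - (w\<^sup>2)\<^sup>2 / 8 \<le> sqrt (1 + w\<^sup>2)"
    using w_pow by (intro sqrt_one_plus_lower) simp_all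
  \<comment> \<open>the difference of the two sides after inserting the three expansions\<close>
  have "0 \<le> w\<^sup>2 * ((1 / 2 - k / 8 - 61 / 800 * k\<^sup>2) - 35 / 144 * k * w
      + (733 / 7680 * k\<^sup>2 - 1 / 8 + k / 36) * w\<^sup>2 + k\<^sup>2 * w ^ 3 * (83 / 3072 - 13 / 17280 * w - 13 / 43200 * w\<^sup>2))"
  proof (intro mult_nonneg_nonneg)
    have k2: "(36 / 25)\<^sup>2 \<le> k\<^sup>2" "k\<^sup>2 \<le> (14433 / 10000)\<^sup>2" using k by (intro power_mono; simp)+
    have "0 \<le> k\<^sup>2 * w ^ 3 * (83 / 3072 - 13 / 17280 * w - 13 / 43200 * w\<^sup>2)"
      using w w_pow by (intro mult_nonneg_nonneg) simp_all
    moreover have "11 / 100 * w\<^sup>2 \<le> (733 / 7680 * k\<^sup>2 - 1 / 8 + k / 36) * w\<^sup>2"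
      using k k2 by (intro mult_right_mono) (simp_all add: power2_eq_square)
    moreover have "0 \<le> (w - 1 / 2)\<^sup>2" by simp
    then have "w - 1 / 4 \<le> w\<^sup>2" by (simp add: power2_eq_square algebra_simps)
    moreover have "k * w \<le> 14433 / 10000 * w" using k w by (intro mult_right_mono) simp_all
    ultimately show "0 \<le> (1 / 2 - k / 8 - 61 / 800 * k\<^sup>2) - 35 / 144 * k * w
      + (733 / 7680 * k\<^sup>2 - 1 / 8 + k / 36) * w\<^sup>2 + k\<^sup>2 * w ^ 3 * (83 / 3072 - 13 / 17280 * w - 13 / 43200 * w\<^sup>2)"
      using w k k2 unfolding power2_eq_square by linarith
  qed simp
  also have "\<dots> = (1 - w) * (1 + h / 2 - h\<^sup>2 / 8) + (1 + w\<^sup>2 / 2 - (w\<^sup>2)\<^sup>2 / 8)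
      - (2 - w) * (1 + g / 2 - 39 / 400 * g\<^sup>2)"
    unfolding h_def g_def
    by (simp add: power2_eq_square power3_eq_cube algebra_simps add_divide_distrib diff_divide_distrib)
  also have "\<dots> \<le> (1 - w) * sqrt (1 + k * - ln (1 - w)) + sqrt (1 + w\<^sup>2)
      - (2 - w) * sqrt (1 + k * - ln (1 - w / 2))"
    using w by (intro diff_mono add_mono mult_left_mono 1 2 3) simp_all
  finally have main: "(2 - w) * sqrt (1 + k * - ln (1 - w / 2))
      \<le> (1 - w) * sqrt (1 + k * - ln (1 - w)) + sqrt (1 + w\<^sup>2)" by simp
  have "sqrt ((1 / 2 - x)\<^sup>2 + (1 / 2)\<^sup>2) = sqrt ((1 + w\<^sup>2) / 4)"
    by (simp add: x power2_eq_square field_simps)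
  also have "\<dots> = sqrt (1 + w\<^sup>2) / 2" by (simp add: real_sqrt_divide)
  finally have r: "sqrt ((1 / 2 - x)\<^sup>2 + (1 / 2)\<^sup>2) = sqrt (1 + w\<^sup>2) / 2" .
  have z: "(x + 1 / 2) / 2 = (1 - w / 2) / 2" by (simp add: x field_simps)
  show ?thesis unfolding r z unfolding x using main w L[of w] L[of "w / 2"] by (simp add: algebra_simps)
qed

text \<open>Scaling by \<open>\<lambda> = 2 y\<close> turns \<open>L t\<close> into \<open>\<lambda> sqrt (c t^2 + (L t)^2)\<close> with \<open>c = log 2 (1 / \<lambda>) \<ge> 0\<close>. Adding the
coordinate \<open>sqrt c t\<close>, which is additive in \<open>t\<close>, to each term preserves the two-point inequality by the triangle inequality in
the plane. So the case \<open>y = 1/2\<close> implies the others.\<close>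

lemma entropy_profile_two_point:
  assumes "0 \<le> x" "x \<le> y" "y \<le> 1 / 2"
  shows "2 * entropy_profile ((x + y) / 2) \<le> entropy_profile x + sqrt ((y - x)\<^sup>2 + (entropy_profile y)\<^sup>2)"
proof (cases "y = 0")
  case False
  then have y: "0 < y" using assms by simp
  define c where "c = log 2 (1 / (2 * y))"
  have c: "0 \<le> c" using y assms by (simp add: c_def)
  have scale: "entropy_profile (2 * y * t) = 2 * y * sqrt (c * t\<^sup>2 + (entropy_profile t)\<^sup>2)"
    if "0 \<le> t" "t \<le> 1" for t
  proof (cases "t = 0")
    case False
    have "log 2 (1 / (2 * y * t)) = c + log 2 (1 / t)"
      using that False y by (simp add: c_def log_inverse_conv ln_mult add_divide_distrib[symmetric] diff_divide_distrib[symmetric])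
    moreover have "c * t\<^sup>2 + (entropy_profile t)\<^sup>2 = t\<^sup>2 * (c + log 2 (1 / t))"
      using that False by (simp add: entropy_profile_def power_mult_distrib algebra_simps)
    ultimately show ?thesis
      using that y by (simp add: entropy_profile_def real_sqrt_mult)
  qed simp
  define t where "t = x / (2 * y)"
  have t: "0 \<le> t" "t \<le> 1 / 2" and xt: "x = 2 * y * t" using assms y by (simp_all add: t_def)
  define a b s where "a = entropy_profile t" and "b = sqrt ((1 / 2 - t)\<^sup>2 + (1 / 2)\<^sup>2)" and "s = (t + 1 / 2) / 2"
  have abs: "0 \<le> a" "0 \<le> b" "0 \<le> entropy_profile s" "2 * entropy_profile s \<le> a + b"
    using entropy_profile_two_point_half[of t] t by (simp_all add: a_def b_def s_def entropy_profile_nonneg)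
  define C where "C = sqrt c"
  have C: "0 \<le> C" "C\<^sup>2 = c" using c by (simp_all add: C_def)
  have "2 * sqrt (c * s\<^sup>2 + (entropy_profile s)\<^sup>2) = sqrt ((C * t + C * (1 / 2))\<^sup>2 + (2 * entropy_profile s)\<^sup>2)"
  proof -
    have "(C * t + C * (1 / 2))\<^sup>2 + (2 * entropy_profile s)\<^sup>2 = 2\<^sup>2 * (c * s\<^sup>2 + (entropy_profile s)\<^sup>2)"
      unfolding C(2)[symmetric] by (simp add: s_def power2_eq_square field_simps)
    then show ?thesis by (simp only: real_sqrt_mult real_sqrt_abs)
  qed
  also have "\<dots> \<le> sqrt ((C * t + C * (1 / 2))\<^sup>2 + (a + b)\<^sup>2)"
    using abs by (intro real_sqrt_le_mono add_left_mono power_mono) simp_all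
  also have "\<dots> \<le> sqrt ((C * t)\<^sup>2 + a\<^sup>2) + sqrt ((C * (1 / 2))\<^sup>2 + b\<^sup>2)"
    by (rule real_sqrt_sum_squares_triangle_ineq)
  finally have mink: "2 * sqrt (c * s\<^sup>2 + (entropy_profile s)\<^sup>2)
      \<le> sqrt (c * t\<^sup>2 + a\<^sup>2) + sqrt (c * (1 / 2)\<^sup>2 + b\<^sup>2)"
    by (simp only: power_mult_distrib C)
  have "2 * y * sqrt (c * (1 / 2)\<^sup>2 + b\<^sup>2) = sqrt ((y - x)\<^sup>2 + (entropy_profile y)\<^sup>2)"
  proof -
    have "(entropy_profile y)\<^sup>2 = (2 * y)\<^sup>2 * (c * (1 / 2)\<^sup>2 + (1 / 2)\<^sup>2)"
      using scale[of "1 / 2"] c by (simp add: entropy_profile_values power_mult_distrib)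
    moreover have "(y - x)\<^sup>2 = (2 * y)\<^sup>2 * (1 / 2 - t)\<^sup>2"
      unfolding xt power_mult_distrib[symmetric] by (simp add: algebra_simps)
    moreover have "b\<^sup>2 = (1 / 2 - t)\<^sup>2 + (1 / 2)\<^sup>2" by (simp add: b_def)
    ultimately have "(y - x)\<^sup>2 + (entropy_profile y)\<^sup>2 = (2 * y)\<^sup>2 * (c * (1 / 2)\<^sup>2 + b\<^sup>2)"
      by (simp add: algebra_simps)
    then show ?thesis using y by (simp add: real_sqrt_mult)
  qed
  moreover have "entropy_profile x = 2 * y * sqrt (c * t\<^sup>2 + a\<^sup>2)"
    using scale[of t] t xt by (simp add: a_def)
  moreover have "entropy_profile ((x + y) / 2) = 2 * y * sqrt (c * s\<^sup>2 + (entropy_profile s)\<^sup>2)"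
  proof -
    have "(x + y) / 2 = 2 * y * s" by (simp add: xt s_def field_simps)
    then show ?thesis using scale[of s] t by (simp add: s_def)
  qed
  ultimately show ?thesis using mult_left_mono[OF mink, of "2 * y"] y by (simp add: algebra_simps)
qed (use assms in simp)

section \<open>The profile of large sets\<close>

text \<open>For \<open>J = u (\<alpha> - \<beta> sqrt u)\<close> one computes \<open>J J'' = - (3/4) \<beta> sqrt u (\<alpha> - \<beta> sqrt u) \<ge> - (3/16) \<alpha>^2\<close>, which exceeds \<open>-2\<close> for the
\<open>\<alpha>\<close> used here. That formula alone would give a smaller slope at \<open>1/2\<close> and leave less room elsewhere, so the first part is a
parabola of curvature close to the extreme one; the two formulas agree at \<open>16/25\<close> to first order.\<close>

definition cap_profile :: "real \<Rightarrow> real" where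
  "cap_profile y = (if y \<le> 16 / 25
     then 1 / 2 + 31 / 200 * (y - 1 / 2) - 193 / 100 * (y - 1 / 2)\<^sup>2
     else (1 - y) * (24461 / 7500 - 43141 / 13500 * sqrt (1 - y)))"

text \<open>The negative derivative of the profile.\<close>

definition cap_slope :: "real \<Rightarrow> real" where
  "cap_slope y = (if y \<le> 16 / 25
     then 193 / 50 * (y - 1 / 2) - 31 / 200
     else 24461 / 7500 - 43141 / 9000 * sqrt (1 - y))"

lemma sqrt_9_25: "sqrt (9 / 25) = 3 / 5"
  by (rule real_sqrt_unique) (simp_all add: power2_eq_square)

lemma cap_profile_le: "y \<le> 16 / 25 \<Longrightarrow>
    cap_profile y = 1 / 2 + 31 / 200 * (y - 1 / 2) - 193 / 100 * (y - 1 / 2)\<^sup>2"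
  and cap_slope_le: "y \<le> 16 / 25 \<Longrightarrow> cap_slope y = 193 / 50 * (y - 1 / 2) - 31 / 200"
  by (simp_all add: cap_profile_def cap_slope_def)

lemma cap_profile_ge: "16 / 25 \<le> y \<Longrightarrow>
    cap_profile y = (1 - y) * (24461 / 7500 - 43141 / 13500 * sqrt (1 - y))"
  and cap_slope_ge: "16 / 25 \<le> y \<Longrightarrow> cap_slope y = 24461 / 7500 - 43141 / 9000 * sqrt (1 - y)"
proof -
  have 1: "(1::real) - 16 / 25 = 9 / 25" by simp
  show "16 / 25 \<le> y \<Longrightarrow>
    cap_profile y = (1 - y) * (24461 / 7500 - 43141 / 13500 * sqrt (1 - y))"
    unfolding cap_profile_def by (cases "y = 16 / 25") (simp_all only: 1 sqrt_9_25, simp_all add: power2_eq_square)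
  show "16 / 25 \<le> y \<Longrightarrow> cap_slope y = 24461 / 7500 - 43141 / 9000 * sqrt (1 - y)"
    unfolding cap_slope_def by (cases "y = 16 / 25") (simp_all only: 1 sqrt_9_25, simp_all)
qed

lemma cap_profile_values: "cap_profile (1 / 2) = 1 / 2" "cap_profile 1 = 0"
  by (simp_all add: cap_profile_def)

lemma cap_profile_has_derivative:
  assumes "y < 1"
  shows "(cap_profile has_real_derivative - cap_slope y) (at y)"
proof -
  define g where "g y = 1 / 2 + 31 / 200 * (y - 1 / 2) - 193 / 100 * (y - 1 / 2)\<^sup>2" for y :: real
  define h where "h y = (1 - y) * (24461 / 7500 - 43141 / 13500 * sqrt (1 - y))" for y :: real
  have g: "(g has_real_derivative - (193 / 50 * (y - 1 / 2) - 31 / 200)) (at y)" for y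
    unfolding g_def by (auto intro!: derivative_eq_intros simp: field_simps)
  have h: "(h has_real_derivative - (24461 / 7500 - 43141 / 9000 * sqrt (1 - y))) (at y)" if "y < 1" for y
  proof -
    define r where "r = sqrt (1 - y)"
    have r: "r * r = 1 - y" "r \<noteq> 0" using that by (simp_all add: r_def)
    have "((\<lambda>y. 1 - y) has_real_derivative - 1) (at y)" by (auto intro!: derivative_eq_intros)
    moreover have "((\<lambda>y. 24461 / 7500 - 43141 / 13500 * sqrt (1 - y)) has_real_derivative 43141 / 27000 / r) (at y)"
      using that by (auto intro!: derivative_eq_intros simp: r_def field_simps)
    ultimately have "(h has_real_derivative - 1 * (24461 / 7500 - 43141 / 13500 * r) + (43141 / 27000 / r) * (1 - y)) (at y)"
      unfolding h_def r_def by (rule DERIV_mult)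
    moreover have "- 1 * (24461 / 7500 - 43141 / 13500 * r) + (43141 / 27000 / r) * (1 - y)
        = - (24461 / 7500 - 43141 / 9000 * r)"
      using r(2) unfolding r(1)[symmetric] by simp
    ultimately show ?thesis by (simp only: r_def)
  qed
  consider "y < 16 / 25" | "16 / 25 < y" | "y = 16 / 25" by linarith
  then show ?thesis
  proof cases
    case 1
    have "(cap_profile has_real_derivative - cap_slope y) (at y) \<longleftrightarrow> (g has_real_derivative - cap_slope y) (at y)"
      by (intro has_field_derivative_cong_ev refl eventually_mono[OF eventually_nhds_in_open[of "{..<16/25}"]])
        (use 1 in \<open>auto simp: cap_profile_le g_def\<close>)
    then show ?thesis using g[of y] 1 by (simp add: cap_slope_le)
  next
    case 2
    have "(cap_profile has_real_derivative - cap_slope y) (at y) \<longleftrightarrow> (h has_real_derivative - cap_slope y) (at y)"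
      by (intro has_field_derivative_cong_ev refl eventually_mono[OF eventually_nhds_in_open[of "{16/25<..}"]])
        (use 2 in \<open>auto simp: cap_profile_ge h_def\<close>)
    then show ?thesis using h[of y] 2 assms by (simp add: cap_slope_ge)
  next
    case 3
    show ?thesis unfolding 3
    proof (rule has_real_derivative_glue)
      show "(g has_real_derivative - cap_slope (16 / 25)) (at (16 / 25))"
        using g[of "16 / 25"] by (simp add: cap_slope_le)
      show "(h has_real_derivative - cap_slope (16 / 25)) (at (16 / 25))"
        using h[of "16 / 25"] by (simp add: cap_slope_ge)
    qed (simp_all add: cap_profile_le cap_profile_ge g_def h_def)
  qed
qed

lemma continuous_on_cap_profile: "continuous_on S cap_profile"
proof -
  define g h where "g y = 1 / 2 + 31 / 200 * (y - 1 / 2) - 193 / 100 * (y - 1 / 2)\<^sup>2"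
    and "h y = (1 - y) * (24461 / 7500 - 43141 / 13500 * sqrt (1 - y))" for y :: real
  have g: "cap_profile y = g y" if "y \<le> 16 / 25" for y using that by (simp only: cap_profile_le g_def)
  have h: "cap_profile y = h y" if "16 / 25 \<le> y" for y using that by (simp only: cap_profile_ge h_def)
  have gh: "h (16 / 25) = g (16 / 25)" by (rule trans[OF sym[OF h[OF order.refl]] g[OF order.refl]])
  have "cap_profile = (\<lambda>y. g (min y (16 / 25)) + h (max y (16 / 25)) - g (16 / 25))"
  proof
    fix y :: real
    show "cap_profile y = g (min y (16 / 25)) + h (max y (16 / 25)) - g (16 / 25)"
    proof (cases "y \<le> 16 / 25")
      case True
      then show ?thesis unfolding g[OF True] min_absorb1[OF True] max_absorb2[OF True] gh by linarith
    next
      case False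
      then have *: "16 / 25 \<le> y" by linarith
      show ?thesis unfolding h[OF *] min_absorb2[OF *] max_absorb1[OF *] by linarith
    qed
  qed
  moreover have "continuous_on S (\<lambda>y. g (min y (16 / 25)) + h (max y (16 / 25)) - g (16 / 25))"
    unfolding g_def h_def by (intro continuous_intros)
  ultimately show ?thesis by (simp only:)
qed

text \<open>The curvature is at least that of the parabola everywhere.\<close>

lemma cap_slope_diff_ge:
  assumes "z \<le> y" "y \<le> 1"
  shows "193 / 50 * (y - z) \<le> cap_slope y - cap_slope z"
proof -
  have quad: "193 / 50 * (y - z) \<le> cap_slope y - cap_slope z" if "z \<le> y" "y \<le> 16 / 25" for y z
    unfolding cap_slope_le[OF that(2)] cap_slope_le[OF order_trans[OF that]] by argo
  have tail: "193 / 50 * (y - z) \<le> cap_slope y - cap_slope z" if "16 / 25 \<le> z" "z \<le> y" "y \<le> 1" for y z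
  proof -
    define R r where "R = sqrt (1 - z)" and "r = sqrt (1 - y)"
    have "r \<le> R" "R \<le> sqrt (9 / 25)" unfolding R_def r_def using that by (intro real_sqrt_le_mono; simp)+
    then have Rr: "0 \<le> r" "r \<le> R" "R \<le> 3 / 5" using that by (simp_all add: r_def sqrt_9_25)
    have "y - z = (R - r) * (R + r)" using that by (simp add: R_def r_def poly_simps)
    also have "\<dots> \<le> (R - r) * (6 / 5)" using Rr by (intro mult_left_mono) simp_all
    finally show ?thesis using that Rr by (simp add: cap_slope_ge R_def[symmetric] r_def[symmetric])
  qed
  consider "y \<le> 16 / 25" | "16 / 25 \<le> z" | "z \<le> 16 / 25" "16 / 25 \<le> y" by linarith
  then show ?thesis
  proof cases
    case 3
    then show ?thesis using quad[of z "16 / 25"] tail[of "16 / 25" y] assms by argo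
  next
    case 1
    then show ?thesis using quad[of z y] assms by simp
  next
    case 2
    then show ?thesis using tail[of z y] assms by simp
  qed
qed

lemma cap_profile_concave: "concave_on {1/2..<1} (\<lambda>y. cap_profile y + 193 / 100 * y\<^sup>2)"
  unfolding concave_on_def
proof (rule convex_on_realI)
  fix y :: real assume y: "y \<in> {1/2..<1}"
  show "((\<lambda>y. - (cap_profile y + 193 / 100 * y\<^sup>2)) has_real_derivative cap_slope y - 193 / 50 * y) (at y)"
    using y cap_profile_has_derivative[of y] by (auto intro!: derivative_eq_intros)
next
  fix z y :: real assume "z \<in> {1/2..<1}" "y \<in> {1/2..<1}" "z \<le> y"
  then show "cap_slope z - 193 / 50 * z \<le> cap_slope y - 193 / 50 * y"
    using cap_slope_diff_ge[of z y] by (simp add: poly_simps)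
qed simp

lemma cap_tail_root_bounds:
  fixes y :: real
  assumes "16 / 25 \<le> y" "y \<le> 1"
  defines "r \<equiv> sqrt (1 - y)"
  shows "0 \<le> r" "r \<le> 3 / 5" "1 - y = r * r"
proof -
  have "r \<le> sqrt (9 / 25)" unfolding r_def using assms by (intro real_sqrt_le_mono) simp
  then show "0 \<le> r" "r \<le> 3 / 5" "1 - y = r * r" using assms by (simp_all add: r_def sqrt_9_25)
qed

lemma cap_profile_pos:
  assumes "1 / 2 \<le> y" "y < 1"
  shows "0 < cap_profile y"
proof (cases "y \<le> 16 / 25")
  case True
  have "(y - 1 / 2) * (y - 1 / 2) \<le> 7 / 50 * (7 / 50)" using True assms by (intro mult_mono) simp_all
  then show ?thesis using assms unfolding cap_profile_le[OF True] by (simp add: poly_simps)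
next
  case False
  then show ?thesis using cap_tail_root_bounds[of y] assms by (simp add: cap_profile_ge)
qed

lemma cap_profile_nonneg: "1 / 2 \<le> y \<Longrightarrow> y \<le> 1 \<Longrightarrow> 0 \<le> cap_profile y"
  using cap_profile_pos[of y] by (cases "y = 1") (simp_all add: cap_profile_values)

text \<open>For the parabola this is \<open>J J'' \<ge> -2\<close>.\<close>

lemma cap_profile_upper:
  assumes "y \<le> 1"
  shows "193 / 100 * cap_profile y \<le> 1"
proof (cases "y \<le> 16 / 25")
  case True
  have "0 \<le> (y - 1 / 2 - 1 / 25)\<^sup>2" by simp
  then show ?thesis using assms True unfolding cap_profile_le[OF True]
    by (simp add: poly_simps)
next
  case False
  define r where "r = sqrt (1 - y)"
  have r: "0 \<le> r" "r \<le> 3 / 5" "1 - y = r * r"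
    using cap_tail_root_bounds[of y] False assms by (simp_all add: r_def)
  have "r * (24461 / 7500 - 43141 / 13500 * r) \<le> 833 / 1000"
  proof -
    have "0 \<le> (r - 51 / 100)\<^sup>2" by simp
    then show ?thesis using r(2) by (simp add: poly_simps)
  qed
  then have "r * (r * (24461 / 7500 - 43141 / 13500 * r)) \<le> 3 / 5 * (833 / 1000)"
    using r by (intro mult_mono mult_nonneg_nonneg) simp_all
  moreover have "cap_profile y = r * (r * (24461 / 7500 - 43141 / 13500 * r))"
    using False cap_profile_ge[of y] unfolding r_def[symmetric] unfolding r(3) by (simp add: mult.assoc)
  ultimately show ?thesis by simp
qed

text \<open>The tangents of the tail at \<open>u = 9/25\<close> and at \<open>u = 9/100\<close>, with rounded coefficients.\<close>

lemma cap_profile_tangent: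
  assumes "16 / 25 \<le> y" "y \<le> 1"
  shows "cap_profile y \<le> 34513 / 100000 + 3854 / 10000 * (1 - y)"
    and "cap_profile y \<le> 4315 / 100000 + 182344 / 100000 * (1 - y)"
proof -
  define r where "r = sqrt (1 - y)"
  have r: "0 \<le> r" "r \<le> 3 / 5" "1 - y = r * r"
    using cap_tail_root_bounds[of y] assms by (simp_all add: r_def)
  have J: "cap_profile y = r * r * (24461 / 7500 - 43141 / 13500 * r)"
    using cap_profile_ge[OF assms(1)] unfolding r_def[symmetric] unfolding r(3) .
  have "0 \<le> (r - 3 / 5)\<^sup>2 * (r + 3 / 10)" using r by simp
  then show "cap_profile y \<le> 34513 / 100000 + 3854 / 10000 * (1 - y)"
    unfolding J r(3) by (simp add: poly_simps)
  have "0 \<le> 43141 / 13500 * ((r - 3 / 10)\<^sup>2 * (r + 3 / 20)) + 1 / 150000 * r\<^sup>2" using r by simp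
  then show "cap_profile y \<le> 4315 / 100000 + 182344 / 100000 * (1 - y)"
    unfolding J r(3) by (simp add: poly_simps)
qed

lemma cap_slope_increment_tail:
  assumes "16 / 25 \<le> z" "z \<le> y" "y \<le> 1"
  shows "cap_profile y * (cap_slope y - cap_slope z) \<le> 2 * (y - z)"
proof -
  define R r where "R = sqrt (1 - z)" and "r = sqrt (1 - y)"
  have "r \<le> R" unfolding R_def r_def using assms by (intro real_sqrt_le_mono) simp
  then have r: "0 \<le> r" "r \<le> R" "1 - y = r * r" "1 - z = R * R" "r \<le> 3 / 5"
    using assms cap_tail_root_bounds[of y] by (simp_all add: R_def r_def)
  have "0 \<le> (r - 51 / 100)\<^sup>2" by simp
  then have "43141 / 9000 * (r * (24461 / 7500 - 43141 / 13500 * r)) \<le> 4"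
    using r(5) by (simp add: poly_simps)
  then have "r * (43141 / 9000 * (r * (24461 / 7500 - 43141 / 13500 * r))) \<le> r * 4"
    using r by (intro mult_left_mono)
  also have "\<dots> \<le> 2 * (R + r)" using r by simp
  finally have "(R - r) * (r * (43141 / 9000 * (r * (24461 / 7500 - 43141 / 13500 * r)))) \<le> (R - r) * (2 * (R + r))"
    using r by (intro mult_left_mono) simp_all
  moreover have "cap_profile y * (cap_slope y - cap_slope z)
      = (R - r) * (r * (43141 / 9000 * (r * (24461 / 7500 - 43141 / 13500 * r))))"
  proof -
    have yz: "16 / 25 \<le> y" using assms by simp
    have J: "cap_profile y = r * r * (24461 / 7500 - 43141 / 13500 * r)"
      using cap_profile_ge[OF yz] unfolding r_def[symmetric] unfolding r(3) .
    show ?thesis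
      unfolding J cap_slope_ge[OF yz] cap_slope_ge[OF assms(1)] R_def[symmetric] r_def[symmetric]
      by (simp add: poly_simps)
  qed
  moreover have "2 * (y - z) = (R - r) * (2 * (R + r))"
    using r(3,4) by (simp add: poly_simps)
  ultimately show ?thesis by simp
qed

lemma cap_slope_increment_quad:
  assumes "z \<le> w" "w \<le> 16 / 25" "w \<le> y" "y \<le> 1"
  shows "cap_profile y * (cap_slope w - cap_slope z) = 193 / 100 * cap_profile y * (2 * (w - z))"
  using assms by (simp add: cap_slope_le poly_simps)

text \<open>The integrated form of \<open>J J'' \<ge> -2\<close> that the monotonicity argument needs. Where \<open>J\<close> decreases it would follow from
\<open>J'' \<ge> -2 / J\<close>; the direct proof also covers the short interval where \<open>J\<close> increases.\<close>

lemma cap_slope_increment: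
  assumes "1 / 2 \<le> z" "z \<le> y" "y \<le> 1"
  shows "cap_profile y * (cap_slope y - cap_slope z) \<le> 2 * (y - z)"
proof -
  have quad: "cap_profile y * (cap_slope w - cap_slope z) \<le> 2 * (w - z)"
    if "z \<le> w" "w \<le> 16 / 25" "w \<le> y" for w
  proof -
    have "193 / 100 * cap_profile y * (2 * (w - z)) \<le> 1 * (2 * (w - z))"
      using that assms cap_profile_upper[of y] by (intro mult_right_mono) simp_all
    then show ?thesis unfolding cap_slope_increment_quad[OF that assms(3)] by (simp only: mult_1)
  qed
  consider "y \<le> 16 / 25" | "16 / 25 \<le> z" | "z \<le> 16 / 25" "16 / 25 \<le> y" by linarith
  then show ?thesis
  proof cases
    case 1 then show ?thesis using quad[of y] assms by simp
  next
    case 2 then show ?thesis using cap_slope_increment_tail[of z y] assms by simp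
  next
    case 3
    have "cap_profile y * (cap_slope y - cap_slope (16 / 25)) \<le> 2 * (y - 16 / 25)"
      using 3 assms by (intro cap_slope_increment_tail) simp_all
    moreover have "cap_profile y * (cap_slope (16 / 25) - cap_slope z) \<le> 2 * (16 / 25 - z)"
      using 3 by (intro quad) simp_all
    ultimately show ?thesis by (simp add: right_diff_distrib)
  qed
qed

text \<open>Up to a positive factor, the right-hand side is the derivative that \<open>cap_gap_mono\<close> needs to be nonnegative. With
\<open>b = J y\<close>, \<open>d = 2 (y - z)\<close>, \<open>\<rho> = sqrt (d^2 + b^2)\<close> and \<open>p = - J'\<close> it equals
\<open>p z (\<rho> - b) + (d - b (p y - p z))\<close>, and the second summand is nonnegative by \<open>cap_slope_increment\<close>. This settles
\<open>p z \<ge> 0\<close>. The slope is negative only for \<open>z\<close> slightly above \<open>1/2\<close>, where \<open>- p z \<le> 31/200\<close>; there the slack in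
\<open>cap_slope_increment\<close> outweighs the first summand.\<close>

lemma cap_increment_condition:
  assumes "1 / 2 \<le> z" "z \<le> y" "y < 1"
  shows "0 \<le> cap_slope z * sqrt ((2 * (y - z))\<^sup>2 + (cap_profile y)\<^sup>2) + 2 * (y - z) - cap_profile y * cap_slope y"
proof -
  define b d \<rho> where "b = cap_profile y" and "d = 2 * (y - z)" and "\<rho> = sqrt (d\<^sup>2 + b\<^sup>2)"
  have b: "0 < b" using cap_profile_pos[of y] assms by (simp add: b_def)
  have "sqrt (b\<^sup>2) \<le> \<rho>" unfolding \<rho>_def by (intro real_sqrt_le_mono) simp
  then have rho: "b \<le> \<rho>" using b by simp
  have inc: "b * (cap_slope y - cap_slope z) \<le> d"
    using cap_slope_increment[of z y] assms by (simp add: b_def d_def)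
  have "- cap_slope z * (\<rho> - b) \<le> d - b * (cap_slope y - cap_slope z)"
  proof (cases "0 \<le> cap_slope z")
    case True
    then have "0 \<le> cap_slope z * (\<rho> - b)" using rho by simp
    then show ?thesis using inc by simp
  next
    case False
    have z: "z \<le> 16 / 25"
    proof (rule ccontr)
      assume "\<not> ?thesis"
      then have "0 \<le> cap_slope z" using cap_slope_diff_ge[of "16 / 25" z] assms by (simp add: cap_slope_le)
      then show False using False by simp
    qed
    define q where "q = - cap_slope z"
    have q: "0 \<le> q" "q = 31 / 200 - 193 / 50 * (z - 1 / 2)" using False z by (simp_all add: q_def cap_slope_le)
    have "q * (\<rho> - b) \<le> d - b * (cap_slope y - cap_slope z)"
    proof (cases "y \<le> 16 / 25")
      case True
      define v where "v = y - 1 / 2"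
      have v: "0 \<le> v" "v \<le> 7 / 50" using True assms by (simp_all add: v_def)
      have bv: "b = 1 / 2 + 31 / 200 * v - 193 / 100 * (v * v)"
        using True by (simp add: b_def cap_profile_le v_def power2_eq_square)
      have "v * v \<le> 7 / 50 * v" using v by (intro mult_right_mono) simp_all
      then have b_ge: "48387 / 100000 \<le> b" unfolding bv using v by linarith
      have "q * d \<le> 31 / 200 * (2 * v)"
        using q assms by (intro mult_mono) (simp_all add: d_def v_def)
      also have "\<dots> \<le> 96774 / 100000 * (1 - 193 / 100 * b)"
      proof -
        \<comment> \<open>the minimum of the quadratic polynomial in \<open>v\<close> is near \<open>0.08316\<close>\<close>
        have "0 \<le> (v - 8316 / 100000)\<^sup>2" by simp
        then show ?thesis unfolding bv using v by (simp add: poly_simps)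
      qed
      also have "\<dots> \<le> 2 * b * (1 - 193 / 100 * b)"
        using b_ge cap_profile_upper[of y] assms by (intro mult_right_mono) (simp_all add: b_def)
      finally have "d * (q * d) \<le> d * (2 * b * (1 - 193 / 100 * b))"
        using assms by (intro mult_left_mono) (simp_all add: d_def)
      then have "q * (d * d / (2 * b)) \<le> d * (1 - 193 / 100 * b)"
        using b by (simp add: field_simps)
      moreover have "\<rho> \<le> b + d * d / (2 * b)"
        unfolding \<rho>_def
      proof (rule real_le_lsqrt)
        have "(b + d * d / (2 * b))\<^sup>2 = d\<^sup>2 + b\<^sup>2 + (d * d / (2 * b))\<^sup>2"
          using b by (simp add: power2_eq_square field_simps)
        then show "d\<^sup>2 + b\<^sup>2 \<le> (b + d * d / (2 * b))\<^sup>2" by simp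
      qed (use b in simp)
      then have "q * (\<rho> - b) \<le> q * (d * d / (2 * b))" using q by (intro mult_left_mono) simp_all
      moreover have "b * (cap_slope y - cap_slope z) = 193 / 100 * b * d"
        using cap_slope_increment_quad[of z y y] assms True by (simp add: b_def d_def)
      ultimately show ?thesis by (simp add: poly_simps)
    next
      case False
      define u where "u = 1 - y"
      have u: "0 \<le> u" "u \<le> 9 / 25" using False assms by (simp_all add: u_def)
      \<comment> \<open>since \<open>q \<le> (31/56) \<cdot> 2 (16/25 - z)\<close> and \<open>d \<le> 1 - 2 u\<close>, it suffices to bound this square root; the bound may be checked at any \<open>c \<ge> b\<close>\<close>
      have key: "sqrt ((1 - 2 * u)\<^sup>2 + b\<^sup>2) \<le> 56 / 31 - (193 * 56 / 3100 - 1) * b"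
        if "b \<le> c" "(1 - 2 * u)\<^sup>2 + c\<^sup>2 \<le> (56 / 31 - (193 * 56 / 3100 - 1) * c)\<^sup>2"
          "(193 * 56 / 3100 - 1) * c \<le> 56 / 31" for c
      proof -
        have "b\<^sup>2 \<le> c\<^sup>2" using b that by (intro power_mono) simp_all
        then have "sqrt ((1 - 2 * u)\<^sup>2 + b\<^sup>2) \<le> 56 / 31 - (193 * 56 / 3100 - 1) * c"
          using that by (intro real_le_lsqrt) simp_all
        then show ?thesis using that(1) by simp
      qed
      have "sqrt ((1 - 2 * u)\<^sup>2 + b\<^sup>2) \<le> 56 / 31 - (193 * 56 / 3100 - 1) * b"
      proof (cases "u \<le> 1 / 5")
        case True
        show ?thesis
        proof (rule key)
          show "b \<le> 4315 / 100000 + 182344 / 100000 * u"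
            using cap_profile_tangent(2)[of y] False assms by (simp add: b_def u_def)
          have "0 \<le> (u - 1 / 5)\<^sup>2" by simp
          then show "(1 - 2 * u)\<^sup>2 + (4315 / 100000 + 182344 / 100000 * u)\<^sup>2
              \<le> (56 / 31 - (193 * 56 / 3100 - 1) * (4315 / 100000 + 182344 / 100000 * u))\<^sup>2"
            using u True by (simp add: poly_simps)
        qed (use True in simp)
      next
        case 2: False
        show ?thesis
        proof (rule key)
          show "b \<le> 34513 / 100000 + 3854 / 10000 * u"
            using cap_profile_tangent(1)[of y] False assms by (simp add: b_def u_def)
          have "0 \<le> (u - 1 / 5) * (9 / 25 - u)" using 2 u by simp
          then show "(1 - 2 * u)\<^sup>2 + (34513 / 100000 + 3854 / 10000 * u)\<^sup>2
              \<le> (56 / 31 - (193 * 56 / 3100 - 1) * (34513 / 100000 + 3854 / 10000 * u))\<^sup>2"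
            using u 2 by (simp add: poly_simps)
        qed (use u in simp)
      qed
      moreover have "\<rho> \<le> sqrt ((1 - 2 * u)\<^sup>2 + b\<^sup>2)"
        unfolding \<rho>_def using assms by (intro real_sqrt_le_mono add_right_mono power_mono) (simp_all add: d_def u_def)
      ultimately have "31 / 56 * (\<rho> - b) \<le> 1 - 193 / 100 * b" by simp
      then have "2 * (16 / 25 - z) * (31 / 56 * (\<rho> - b)) \<le> 2 * (16 / 25 - z) * (1 - 193 / 100 * b)"
        using z by (intro mult_left_mono) simp_all
      moreover have "q * (\<rho> - b) \<le> 31 / 56 * (2 * (16 / 25 - z)) * (\<rho> - b)"
        using rho assms z unfolding q(2) by (intro mult_right_mono) (simp_all add: poly_simps)
      moreover have "b * (cap_slope y - cap_slope (16 / 25)) \<le> 2 * (y - 16 / 25)"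
        using cap_slope_increment_tail[of "16 / 25" y] False assms by (simp add: b_def)
      moreover have "b * (cap_slope (16 / 25) - cap_slope z) = 193 / 100 * b * (2 * (16 / 25 - z))"
        using cap_slope_increment_quad[of z "16 / 25" y] z False assms by (simp add: b_def)
      ultimately show ?thesis by (simp add: d_def poly_simps)
    qed
    then show ?thesis by (simp add: q_def)
  qed
  then show ?thesis unfolding b_def[symmetric] d_def[symmetric] \<rho>_def[symmetric] by (simp add: algebra_simps)
qed

text \<open>Every pair with \<open>x + y \<ge> 1\<close> is reached from the line \<open>x + y = 1\<close> or from the diagonal by increasing \<open>y\<close>. The midpoint
remains in \<open>[1/2, 1]\<close> on the way, so the derivative involves \<open>J\<close> only.\<close>

lemma cap_gap_mono:
  assumes "1 / 2 \<le> a" "1 \<le> x + a" "x \<le> a" "a \<le> y" "y \<le> 1"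
  shows "sqrt ((a - x)\<^sup>2 + (cap_profile a)\<^sup>2) - 2 * cap_profile ((x + a) / 2)
    \<le> sqrt ((y - x)\<^sup>2 + (cap_profile y)\<^sup>2) - 2 * cap_profile ((x + y) / 2)"
proof (rule DERIV_nonneg_imp_increasing_open[OF assms(4)])
  show "continuous_on {a..y} (\<lambda>t. sqrt ((t - x)\<^sup>2 + (cap_profile t)\<^sup>2) - 2 * cap_profile ((x + t) / 2))"
    by (intro continuous_intros continuous_on_compose2[OF continuous_on_cap_profile[of UNIV]] continuous_on_cap_profile) auto
  fix t assume t: "a < t" "t < y"
  define z \<rho> where "z = (x + t) / 2" and "\<rho> = sqrt ((t - x)\<^sup>2 + (cap_profile t)\<^sup>2)"
  have z: "1 / 2 \<le> z" "z \<le> t" "z < 1" "2 * (t - z) = t - x" using t assms by (simp_all add: z_def field_simps)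
  have pos: "0 < cap_profile t" using t assms by (intro cap_profile_pos) simp_all
  then have "0 < (t - x)\<^sup>2 + (cap_profile t)\<^sup>2" by (simp add: add_nonneg_pos)
  then have rho: "0 < \<rho>" by (simp add: \<rho>_def)
  have "((\<lambda>t. (t - x)\<^sup>2 + (cap_profile t)\<^sup>2) has_real_derivative
      2 * (t - x) + 2 * cap_profile t * - cap_slope t) (at t)"
    using t assms by (auto intro!: derivative_eq_intros cap_profile_has_derivative)
  then have "((\<lambda>t. sqrt ((t - x)\<^sup>2 + (cap_profile t)\<^sup>2)) has_real_derivative
      inverse \<rho> / 2 * (2 * (t - x) + 2 * cap_profile t * - cap_slope t)) (at t)"
    unfolding \<rho>_def by (rule DERIV_chain2[OF DERIV_real_sqrt, rotated]) (rule \<open>0 < (t - x)\<^sup>2 + (cap_profile t)\<^sup>2\<close>)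
  then have droot: "((\<lambda>t. sqrt ((t - x)\<^sup>2 + (cap_profile t)\<^sup>2)) has_real_derivative
      (t - x - cap_profile t * cap_slope t) / \<rho>) (at t)"
    by (rule DERIV_cong) (use rho in \<open>simp add: field_simps\<close>)
  have "((\<lambda>t. cap_profile ((x + t) / 2)) has_real_derivative - cap_slope z * (1 / 2)) (at t)"
    unfolding z_def by (rule DERIV_chain2[OF cap_profile_has_derivative]) (use z in \<open>auto intro!: derivative_eq_intros simp: z_def\<close>)
  then have "((\<lambda>t. sqrt ((t - x)\<^sup>2 + (cap_profile t)\<^sup>2) - 2 * cap_profile ((x + t) / 2)) has_real_derivative
      (t - x - cap_profile t * cap_slope t) / \<rho> - 2 * (- cap_slope z * (1 / 2))) (at t)"
    by (intro DERIV_diff DERIV_cmult droot)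
  moreover have "0 \<le> (t - x - cap_profile t * cap_slope t) / \<rho> - 2 * (- cap_slope z * (1 / 2))"
  proof -
    have "0 \<le> cap_slope z * \<rho> + (t - x) - cap_profile t * cap_slope t"
      using cap_increment_condition[of z t] z t assms unfolding z(4) by (simp add: \<rho>_def)
    then have "0 \<le> (cap_slope z * \<rho> + (t - x) - cap_profile t * cap_slope t) / \<rho>" using rho by simp
    also have "\<dots> = (t - x - cap_profile t * cap_slope t) / \<rho> - 2 * (- cap_slope z * (1 / 2))"
      using rho by (simp add: field_simps)
    finally show ?thesis .
  qed
  ultimately show "\<exists>D. ((\<lambda>t. sqrt ((t - x)\<^sup>2 + (cap_profile t)\<^sup>2) - 2 * cap_profile ((x + t) / 2)) has_real_derivative D) (at t) \<and> 0 \<le> D"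
    by blast
qed

section \<open>The two-point inequality across one half\<close>

lemma cap_profile_tail_ge:
  assumes "16 / 25 \<le> y" "y \<le> 1" "sqrt (1 - y) \<le> r"
  shows "(1 - y) * (24461 / 7500 - 43141 / 13500 * r) \<le> cap_profile y"
  unfolding cap_profile_ge[OF assms(1)] using assms by (intro mult_left_mono) simp_all

lemma cap_profile_points:
  "cap_profile (57 / 100) = 501393 / 1000000"
  "cap_profile (16 / 25) = 483872 / 1000000"
  "4533 / 10000 \<le> cap_profile (7 / 10)"
  "41591 / 100000 \<le> cap_profile (3 / 4)"
  "35206 / 100000 \<le> cap_profile (13 / 16)"
  "26643 / 100000 \<le> cap_profile (7 / 8)"
  "15390 / 100000 \<le> cap_profile (15 / 16)"
proof -
  show "cap_profile (57 / 100) = 501393 / 1000000" "cap_profile (16 / 25) = 483872 / 1000000"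
    by (simp_all add: cap_profile_def power2_eq_square)
  have "sqrt (1 - 7 / 10) \<le> 54773 / 100000" by (rule real_le_lsqrt) (simp_all add: power2_eq_square)
  from cap_profile_tail_ge[OF _ _ this] show "4533 / 10000 \<le> cap_profile (7 / 10)" by simp
  have "sqrt (1 - 3 / 4) \<le> 1 / 2" by (rule real_le_lsqrt) (simp_all add: power2_eq_square)
  from cap_profile_tail_ge[OF _ _ this] show "41591 / 100000 \<le> cap_profile (3 / 4)" by simp
  have "sqrt (1 - 13 / 16) \<le> 43302 / 100000" by (rule real_le_lsqrt) (simp_all add: power2_eq_square)
  from cap_profile_tail_ge[OF _ _ this] show "35206 / 100000 \<le> cap_profile (13 / 16)" by simp
  have "sqrt (1 - 7 / 8) \<le> 35356 / 100000" by (rule real_le_lsqrt) (simp_all add: power2_eq_square)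
  from cap_profile_tail_ge[OF _ _ this] show "26643 / 100000 \<le> cap_profile (7 / 8)" by simp
  have "sqrt (1 - 15 / 16) \<le> 1 / 4" by (rule real_le_lsqrt) (simp_all add: power2_eq_square)
  from cap_profile_tail_ge[OF _ _ this] show "15390 / 100000 \<le> cap_profile (15 / 16)" by simp
qed

lemma cap_profile_concave_Icc:
  "1 / 2 \<le> a \<Longrightarrow> b < 1 \<Longrightarrow> concave_on {a..b} (\<lambda>y. cap_profile y + 193 / 100 * y\<^sup>2)"
  by (rule concave_on_subset[OF cap_profile_concave]) auto

lemma cap_profile_reflected_concave: "concave_on {0<..1/2} (\<lambda>x. cap_profile (1 - x))"
  unfolding concave_on_def
proof (rule convex_on_realI)
  fix x :: real assume x: "x \<in> {0<..1/2}"
  have "((\<lambda>x. cap_profile (1 - x)) has_real_derivative - cap_slope (1 - x) * - 1) (at x)"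
    by (rule DERIV_chain2[OF cap_profile_has_derivative]) (use x in \<open>auto intro!: derivative_eq_intros\<close>)
  from DERIV_minus[OF this]
  show "((\<lambda>x. - cap_profile (1 - x)) has_real_derivative - cap_slope (1 - x)) (at x)" by simp
next
  fix x y :: real assume "x \<in> {0<..1/2}" "y \<in> {0<..1/2}" "x \<le> y"
  then show "- cap_slope (1 - x) \<le> - cap_slope (1 - y)"
    using cap_slope_diff_ge[of "1 - y" "1 - x"] by simp
qed simp

text \<open>Near \<open>x = 0\<close>, an equality case, \<open>L x \<ge> 2 x\<close> is enough. On the other pieces both \<open>L x\<close> and \<open>J (1 - x)\<close> are concave, so after
replacing the square root by a tangent plane the end points decide.\<close>

lemma antidiagonal_entropy:
  assumes "0 \<le> x" "x \<le> 1 / 4"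
  shows "1 \<le> entropy_profile x + sqrt ((1 - 2 * x)\<^sup>2 + (cap_profile (1 - x))\<^sup>2)"
proof -
  have piece: "1 \<le> entropy_profile x + sqrt ((1 - 2 * x)\<^sup>2 + (cap_profile (1 - x))\<^sup>2)"
    if "0 < a" "b \<le> 1 / 4" "a \<le> x" "x \<le> b" and cs: "0 \<le> c" "c\<^sup>2 + s\<^sup>2 \<le> 1"
      and a: "1 \<le> entropy_profile a + c * cap_profile (1 - a) + s * (1 - 2 * a)"
      and b: "1 \<le> entropy_profile b + c * cap_profile (1 - b) + s * (1 - 2 * b)" for a b c s :: real
  proof -
    have "concave_on {a..b} (\<lambda>x. (entropy_profile x + 7 / 8 * x\<^sup>2) + c * cap_profile (1 - x))"
      using that by (intro concave_on_add concave_on_cmul entropy_profile_concave_Icc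
          concave_on_subset[OF cap_profile_reflected_concave]) auto
    then have "concave_on {a..b} (\<lambda>x. (entropy_profile x + c * cap_profile (1 - x)) + 7 / 8 * x\<^sup>2)"
      by (simp add: add_ac)
    then have "0 \<le> 1 * (entropy_profile x + c * cap_profile (1 - x)) + (0 * x\<^sup>2 + (- 2 * s) * x + (s - 1))"
      by (rule concave_on_Icc_nonneg) (use that a b in \<open>auto simp: algebra_simps\<close>)
    moreover have "c * cap_profile (1 - x) + s * (1 - 2 * x) \<le> sqrt ((1 - 2 * x)\<^sup>2 + (cap_profile (1 - x))\<^sup>2)"
      using cs by (intro cos_sin_le_hypot)
    ultimately show ?thesis by (simp add: algebra_simps)
  qed
  consider "x \<le> 1 / 16" | "1 / 16 \<le> x" "x \<le> 1 / 8" | "1 / 8 \<le> x" "x \<le> 3 / 16" | "3 / 16 \<le> x" by linarith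
  then show ?thesis
  proof cases
    case 1
    have "log 2 (1 / (1 / 16 :: real)) = 2\<^sup>2" using log_pow_cancel[of 2 4] by simp
    then have "2 * x \<le> entropy_profile x"
      using entropy_profile_ge_linear[of x "1 / 16"] 1 assms by simp
    moreover have "1 - 2 * x \<le> sqrt ((1 - 2 * x)\<^sup>2 + (cap_profile (1 - x))\<^sup>2)"
      by (rule real_le_rsqrt) simp
    ultimately show ?thesis by linarith
  next
    case 2
    show ?thesis
      by (rule piece[of "1 / 16" "1 / 8" "259 / 1000" "9658 / 10000"])
        (use 2 sqrt3_bounds cap_profile_points in \<open>simp_all add: entropy_profile_values power2_eq_square\<close>)
  next
    case 3
    show ?thesis
      by (rule piece[of "1 / 8" "3 / 16" "437 / 1000" "8994 / 10000"])
        (use 3 sqrt3_bounds cap_profile_points entropy_profile_3_16 in \<open>simp_all add: entropy_profile_values power2_eq_square\<close>)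
  next
    case 4
    show ?thesis
      by (rule piece[of "3 / 16" "1 / 4" "597 / 1000" "8022 / 10000"])
        (use 4 assms sqrt2_bounds cap_profile_points entropy_profile_3_16 in \<open>simp_all add: entropy_profile_values power2_eq_square\<close>)
  qed
qed

text \<open>With \<open>w = 1/2 - x\<close> both values are parabolas for \<open>w \<le> 7/50\<close>, and the linear terms cancel because \<open>Q\<close> and \<open>J\<close> have
the same slope at \<open>1/2\<close>; the rest is done by tangent planes and concavity.\<close>

lemma antidiagonal_mid:
  assumes "1 / 4 \<le> x" "x \<le> 1 / 2"
  shows "1 \<le> mid_profile x + sqrt ((1 - 2 * x)\<^sup>2 + (cap_profile (1 - x))\<^sup>2)"
proof -
  define q where "q = mid_curv"
  have q: "17231 / 10000 < q" "q < 17232 / 10000" using mid_curv_bounds by (simp_all add: q_def)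
  have piece: "1 \<le> mid_profile x + sqrt ((1 - 2 * x)\<^sup>2 + (cap_profile (1 - x))\<^sup>2)"
    if "1 / 2 \<le> a" "b < 1" "a \<le> 1 - x" "1 - x \<le> b" and cs: "0 \<le> c" "c\<^sup>2 + s\<^sup>2 \<le> 1"
      and a: "0 \<le> c * cap_profile a + (- q * a\<^sup>2 + (2 * s - 31 / 200 + q) * a + (31 / 400 - q / 4 - 1 / 2 - s))"
      and b: "0 \<le> c * cap_profile b + (- q * b\<^sup>2 + (2 * s - 31 / 200 + q) * b + (31 / 400 - q / 4 - 1 / 2 - s))" for a b c s :: real
  proof -
    have "- q \<le> c * (193 / 100)" by (rule order_trans[of _ 0]) (use cs q in simp_all)
    then have "0 \<le> c * cap_profile (1 - x)
        + (- q * (1 - x)\<^sup>2 + (2 * s - 31 / 200 + q) * (1 - x) + (31 / 400 - q / 4 - 1 / 2 - s))"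
      by (rule concave_on_Icc_nonneg[OF cap_profile_concave_Icc[OF that(1,2)] that(3,4) cs(1) _ a b])
    also have "- q * (1 - x)\<^sup>2 + (2 * s - 31 / 200 + q) * (1 - x) + (31 / 400 - q / 4 - 1 / 2 - s)
        = mid_profile x - 1 + s * (1 - 2 * x)"
      by (simp add: mid_profile_def q_def[symmetric] poly_simps)
    moreover have "c * cap_profile (1 - x) + s * (1 - 2 * x) \<le> sqrt ((1 - 2 * x)\<^sup>2 + (cap_profile (1 - x))\<^sup>2)"
      using cs by (intro cos_sin_le_hypot)
    ultimately show ?thesis by linarith
  qed
  consider "9 / 25 \<le> x" | "x \<le> 9 / 25" "3 / 10 \<le> x" | "x \<le> 3 / 10" by linarith
  then show ?thesis
  proof cases
    case 1
    define w where "w = 1 / 2 - x"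
    have w: "0 \<le> w" "w \<le> 7 / 50" "1 - 2 * x = 2 * w" using 1 assms by (simp_all add: w_def)
    have J: "cap_profile (1 - x) = 1 / 2 + 31 / 200 * w - 193 / 100 * w\<^sup>2"
      using 1 by (simp add: cap_profile_le w_def)
    have Q: "mid_profile x = 1 / 2 - 31 / 200 * w - q * w\<^sup>2"
      by (simp add: mid_profile_def w_def q_def)
    define A B where "A = 31 / 100 * (193 / 100 + q) * w" and "B = (193 / 100 * (193 / 100) - q * q) * w\<^sup>2"
    have "A \<le> 31 / 100 * (193 / 100 + 17232 / 10000) * (7 / 50)"
      unfolding A_def using w q by (intro mult_mono) simp_all
    moreover have "q * q \<le> 193 / 100 * (193 / 100)" using q by (intro mult_mono) simp_all
    then have "0 \<le> B" by (simp add: B_def)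
    ultimately have "0 \<le> (4 - 193 / 100 - q) - A + B" using q by simp
    then have "0 \<le> w\<^sup>2 * ((4 - 193 / 100 - q) - 31 / 100 * (193 / 100 + q) * w + (193 / 100 * (193 / 100) - q * q) * w\<^sup>2)"
      unfolding A_def B_def by (intro mult_nonneg_nonneg) simp_all
    also have "\<dots> = (2 * w)\<^sup>2 + (1 / 2 + 31 / 200 * w - 193 / 100 * w\<^sup>2)\<^sup>2 - (1 / 2 + 31 / 200 * w + q * w\<^sup>2)\<^sup>2"
      by (simp add: poly_simps)
    finally have "1 / 2 + 31 / 200 * w + q * w\<^sup>2 \<le> sqrt ((2 * w)\<^sup>2 + (1 / 2 + 31 / 200 * w - 193 / 100 * w\<^sup>2)\<^sup>2)"
      by (intro real_le_rsqrt) simp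
    then show ?thesis unfolding J Q w(3) by linarith
  next
    case 2
    show ?thesis
      by (rule piece[of "16 / 25" "7 / 10" "816 / 1000" "578 / 1000"])
        (use 2 q cap_profile_points in \<open>simp_all add: poly_simps\<close>)
  next
    case 3
    show ?thesis
      by (rule piece[of "7 / 10" "3 / 4" "690 / 1000" "7238 / 10000"])
        (use 3 assms q cap_profile_points in \<open>simp_all add: poly_simps\<close>)
  qed
qed

text \<open>For fixed \<open>y\<close> the function \<open>F\<close> is concave in \<open>x\<close>, and for fixed \<open>x\<close> it is concave in \<open>y\<close> as soon as \<open>c\<close> times the curvature of
\<open>J\<close> dominates that of the parabola, which is ensured by \<open>c \<ge> 9/20\<close>.\<close>

lemma rectangle_two_point:
  fixes c s x0 x1 y0 y1 :: real
  defines "F \<equiv> \<lambda>x y. entropy_profile x + c * cap_profile y + s * (y - x)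
      - (1 - 31 / 200 * (1 - x - y) - mid_curv / 2 * (1 - x - y)\<^sup>2)"
  assumes cs: "9 / 20 \<le> c" "c\<^sup>2 + s\<^sup>2 \<le> 1"
    and range: "0 \<le> x0" "x1 \<le> 1 / 4" "1 / 2 \<le> y0" "y1 < 1"
    and corners: "0 \<le> F x0 y0" "0 \<le> F x0 y1" "0 \<le> F x1 y0" "0 \<le> F x1 y1"
    and x: "x0 \<le> x" "x \<le> x1" and y: "y0 \<le> y" "y \<le> y1"
  shows "2 * mid_profile ((x + y) / 2) \<le> entropy_profile x + sqrt ((y - x)\<^sup>2 + (cap_profile y)\<^sup>2)"
proof -
  define q where "q = mid_curv"
  have q: "17231 / 10000 < q" "q < 17232 / 10000" using mid_curv_bounds by (simp_all add: q_def)
  have Fy: "F x y = c * cap_profile y + (q / 2 * y\<^sup>2 + (s - 31 / 200 - q * (1 - x)) * y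
      + (entropy_profile x - s * x - 1 + 31 / 200 * (1 - x) + q / 2 * (1 - x)\<^sup>2))" for x y
    unfolding F_def q_def[symmetric] by (simp add: poly_simps)
  have Fx: "F x y = 1 * entropy_profile x + (q / 2 * x\<^sup>2 + (- s - 31 / 200 - q * (1 - y)) * x
      + (c * cap_profile y + s * y - 1 + 31 / 200 * (1 - y) + q / 2 * (1 - y)\<^sup>2))" for x y
    unfolding F_def q_def[symmetric] by (simp add: poly_simps)
  have "0 \<le> F x' y" if "x' = x0 \<or> x' = x1" for x'
    unfolding Fy by (rule concave_on_Icc_nonneg[OF cap_profile_concave_Icc[OF range(3,4)] y])
      (use cs q corners[unfolded Fy] that in auto)
  then have "0 \<le> F x y"
    unfolding Fx by (intro concave_on_Icc_nonneg[OF entropy_profile_concave_Icc[OF range(1,2)] x])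
      (use q in \<open>auto simp: Fx\<close>)
  moreover have "c * cap_profile y + s * (y - x) \<le> sqrt ((y - x)\<^sup>2 + (cap_profile y)\<^sup>2)"
    using cs by (intro cos_sin_le_hypot)
  ultimately show ?thesis unfolding F_def mid_profile_double by linarith
qed

lemmas corner_facts = cap_profile_points cap_profile_values entropy_profile_values

text \<open>In each rectangle \<open>(c, s)\<close> is close to the direction of \<open>(J y, y - x)\<close> near its centre, with \<open>c^2 + s^2\<close> just below \<open>1\<close>.\<close>

lemma entropy_cap_two_point_euclidean:
  assumes "1 / 2 \<le> y" "1 / 16 \<le> x" "x \<le> 1 / 4"
    and "y \<le> 16 / 25 \<or> (1 / 8 \<le> x \<and> y \<le> 7 / 10) \<or> (x = 1 / 4 \<and> y \<le> 3 / 4)"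
  shows "2 * mid_profile ((x + y) / 2) \<le> entropy_profile x + sqrt ((y - x)\<^sup>2 + (cap_profile y)\<^sup>2)"
proof -
  note facts = mid_curv_bounds sqrt2_bounds sqrt3_bounds entropy_profile_3_16 cap_profile_points
  have "(y \<le> 57 / 100 \<and> x \<le> 1 / 8)
    \<or> (y \<le> 57 / 100 \<and> 1 / 8 \<le> x)
    \<or> (57 / 100 \<le> y \<and> y \<le> 16 / 25 \<and> x \<le> 1 / 8)
    \<or> (57 / 100 \<le> y \<and> y \<le> 16 / 25 \<and> 1 / 8 \<le> x \<and> x \<le> 3 / 16)
    \<or> (57 / 100 \<le> y \<and> y \<le> 16 / 25 \<and> 3 / 16 \<le> x)
    \<or> (16 / 25 \<le> y \<and> y \<le> 7 / 10 \<and> 1 / 8 \<le> x \<and> x \<le> 3 / 16)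
    \<or> (16 / 25 \<le> y \<and> y \<le> 7 / 10 \<and> 3 / 16 \<le> x)
    \<or> (7 / 10 \<le> y \<and> y \<le> 3 / 4 \<and> x = 1 / 4)"
    using assms by argo
  then consider "y \<le> 57 / 100" "x \<le> 1 / 8" | "y \<le> 57 / 100" "1 / 8 \<le> x"
    | "57 / 100 \<le> y" "y \<le> 16 / 25" "x \<le> 1 / 8" | "57 / 100 \<le> y" "y \<le> 16 / 25" "1 / 8 \<le> x" "x \<le> 3 / 16"
    | "57 / 100 \<le> y" "y \<le> 16 / 25" "3 / 16 \<le> x" | "16 / 25 \<le> y" "y \<le> 7 / 10" "1 / 8 \<le> x" "x \<le> 3 / 16"
    | "16 / 25 \<le> y" "y \<le> 7 / 10" "3 / 16 \<le> x" | "7 / 10 \<le> y" "y \<le> 3 / 4" "x = 1 / 4"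
    by blast
  then show ?thesis
  proof cases
    case 1
    show ?thesis
      by (rule rectangle_two_point[of "703 / 1000" "711 / 1000" "1 / 16" "1 / 8" "1 / 2" "57 / 100"])
        (use 1 assms facts in \<open>simp_all add: corner_facts poly_simps\<close>)
  next
    case 2
    show ?thesis
      by (rule rectangle_two_point[of "855 / 1000" "5186 / 10000" "1 / 8" "1 / 4" "1 / 2" "57 / 100"])
        (use 2 assms facts in \<open>simp_all add: corner_facts poly_simps\<close>)
  next
    case 3
    show ?thesis
      by (rule rectangle_two_point[of "642 / 1000" "7667 / 10000" "1 / 16" "1 / 8" "57 / 100" "16 / 25"])
        (use 3 assms facts in \<open>simp_all add: corner_facts poly_simps\<close>)
  next
    case 4
    show ?thesis
      by (rule rectangle_two_point[of "722 / 1000" "6918 / 10000" "1 / 8" "3 / 16" "57 / 100" "16 / 25"])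
        (use 4 assms facts in \<open>simp_all add: corner_facts poly_simps\<close>)
  next
    case 5
    show ?thesis
      by (rule rectangle_two_point[of "797 / 1000" "6039 / 10000" "3 / 16" "1 / 4" "57 / 100" "16 / 25"])
        (use 5 assms facts in \<open>simp_all add: corner_facts poly_simps\<close>)
  next
    case 6
    show ?thesis
      by (rule rectangle_two_point[of "646 / 1000" "7633 / 10000" "1 / 8" "3 / 16" "16 / 25" "7 / 10"])
        (use 6 assms facts in \<open>simp_all add: corner_facts poly_simps\<close>)
  next
    case 7
    show ?thesis
      by (rule rectangle_two_point[of "730 / 1000" "6834 / 10000" "3 / 16" "1 / 4" "16 / 25" "7 / 10"])
        (use 7 assms facts in \<open>simp_all add: corner_facts poly_simps\<close>)
  next
    case 8
    show ?thesis
      by (rule rectangle_two_point[of "694 / 1000" "7199 / 10000" "1 / 4" "1 / 4" "7 / 10" "3 / 4"])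
        (use 8 assms facts in \<open>simp_all add: corner_facts poly_simps\<close>)
  qed
qed

text \<open>As for two points on the parabola, \<open>2 Q z = Q x + m + q e / 2\<close> with \<open>e = (y - x)^2\<close>, where \<open>m\<close> is the value at \<open>y\<close> of the
parabola, continued beyond \<open>1/2\<close>. The claim \<open>(m + q e / 2)^2 \<le> e + (J y)^2\<close> is a concave condition in \<open>e\<close>.\<close>

lemma mid_cap_two_point:
  assumes "1 / 4 \<le> x" "x \<le> 1 / 2" "1 / 2 \<le> y" "x + y \<le> 1"
  shows "2 * mid_profile ((x + y) / 2) \<le> mid_profile x + sqrt ((y - x)\<^sup>2 + (cap_profile y)\<^sup>2)"
proof -
  define q m b where "q = mid_curv" and "m = mid_profile y" and "b = cap_profile y"
  have q: "17231 / 10000 < q" "q < 17232 / 10000" using mid_curv_bounds by (simp_all add: q_def)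
  have y: "y \<le> 3 / 4" using assms by simp
  have second_difference: "2 * mid_profile ((x + y) / 2) = mid_profile x + (m + q / 2 * (y - x)\<^sup>2)" for x
    by (simp add: mid_profile_def m_def q_def power2_eq_square field_simps)
  have "q * ((y - 1 / 2) * (y - 1 / 2)) \<le> 2 * (1 / 4 * (1 / 4))"
    using q assms y by (intro mult_mono) simp_all
  then have m: "0 \<le> m" using assms by (simp add: m_def mid_profile_def q_def power2_eq_square poly_simps)
  have end_point: "0 \<le> - (q\<^sup>2 / 4) * e\<^sup>2 + (1 - q * m) * e + (b\<^sup>2 - m\<^sup>2)"
    if "m + q / 2 * e \<le> sqrt (e + b\<^sup>2)" "0 \<le> e" for e
  proof -
    have "(m + q / 2 * e)\<^sup>2 \<le> (sqrt (e + b\<^sup>2))\<^sup>2"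
      using that m q by (intro power_mono) simp_all
    then have "(m + q / 2 * e)\<^sup>2 \<le> e + b\<^sup>2" using that by simp
    then show ?thesis by (simp add: poly_simps)
  qed
  have "m + q / 2 * (y - 1 / 4)\<^sup>2 \<le> sqrt ((y - 1 / 4)\<^sup>2 + b\<^sup>2)"
    using entropy_cap_two_point_euclidean[of y "1 / 4"] assms y
    unfolding second_difference by (simp add: b_def mid_profile_values entropy_profile_values)
  note far = end_point[OF this]
  have "2 * mid_profile (((1 - y) + y) / 2) = 1" by (simp add: mid_profile_values)
  then have "m + q / 2 * (y - (1 - y))\<^sup>2 \<le> sqrt ((y - (1 - y))\<^sup>2 + b\<^sup>2)"
    using antidiagonal_mid[of "1 - y"] assms y unfolding second_difference by (simp add: b_def)
  note near = end_point[OF this]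
  have "concave_on {(y - (1 - y))\<^sup>2..(y - 1 / 4)\<^sup>2} (\<lambda>e. 0 + 0 * e\<^sup>2 :: real)" by (simp add: concave_on_const)
  then have "0 \<le> 0 * 0 + (- (q\<^sup>2 / 4) * ((y - x)\<^sup>2)\<^sup>2 + (1 - q * m) * (y - x)\<^sup>2 + (b\<^sup>2 - m\<^sup>2))"
    by (rule concave_on_Icc_nonneg) (use assms near far in \<open>auto intro: power_mono\<close>)
  then have "(m + q / 2 * (y - x)\<^sup>2)\<^sup>2 \<le> (y - x)\<^sup>2 + b\<^sup>2" by (simp add: poly_simps)
  then have "m + q / 2 * (y - x)\<^sup>2 \<le> sqrt ((y - x)\<^sup>2 + b\<^sup>2)" by (rule real_le_rsqrt)
  then show ?thesis unfolding second_difference by (simp add: b_def)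
qed

text \<open>At \<open>x = 0\<close> and \<open>y = 1/2\<close> there is equality; the value \<open>mid_curv\<close> makes the constant terms cancel exactly. Beyond
\<open>16/25\<close> a factor \<open>1 - y\<close> splits off, which takes care of the equality at \<open>y = 1\<close>.\<close>

lemma linear_two_point_0:
  assumes "1 / 2 \<le> y" "y \<le> 1"
  shows "2 * mid_profile ((0 + y) / 2) \<le> y + (sqrt 2 - 1) * cap_profile y"
proof (cases "y \<le> 16 / 25")
  case True
  define v where "v = y - 1 / 2"
  have v: "0 \<le> v" "y = 1 / 2 + v" using assms by (simp_all add: v_def)
  have "0 \<le> v * (431 / 200 * sqrt 2 - 3) + v\<^sup>2 * (562 / 100 - 393 / 100 * sqrt 2)"
    using v sqrt2_bounds by (intro add_nonneg_nonneg mult_nonneg_nonneg) simp_all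
  then show ?thesis
    unfolding cap_profile_le[OF True] mid_profile_double mid_curv_def unfolding v(2)
    by (simp add: poly_simps)
next
  case False
  define r where "r = sqrt (1 - y)"
  have r: "0 \<le> r" "r \<le> 3 / 5" "1 - y = r * r"
    using cap_tail_root_bounds[of y] False assms by (simp_all add: r_def)
  have "16 / 25 \<le> y" using False by simp
  note J = cap_profile_ge[OF this]
  have "41421 / 100000 * (24461 / 7500 - 43141 / 13500 * r) \<le> (sqrt 2 - 1) * (24461 / 7500 - 43141 / 13500 * r)"
    using sqrt2_bounds r by (intro mult_right_mono) simp_all
  moreover have "17231 / 20000 * (r * r) \<le> mid_curv / 2 * (r * r)"
    using mid_curv_bounds by (intro mult_right_mono) simp_all
  moreover have "0 \<le> (r - 3 / 5)\<^sup>2" by simp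
  ultimately have "0 \<le> (sqrt 2 - 1) * (24461 / 7500 - 43141 / 13500 * r) - 169 / 200 + mid_curv / 2 * (r * r)"
    using r(1,2) by (simp add: poly_simps)
  then have "0 \<le> r * r * ((sqrt 2 - 1) * (24461 / 7500 - 43141 / 13500 * r) - 169 / 200 + mid_curv / 2 * (r * r))"
    using r(1) by (intro mult_nonneg_nonneg) simp_all
  moreover have y: "y = 1 - r * r" using r(3) by simp
  ultimately show ?thesis
    unfolding J mid_profile_double r_def[symmetric] unfolding y by (simp add: poly_simps)
qed

text \<open>With the linear term of the maximum the difference of the two sides is concave in \<open>x\<close> on all of \<open>[0, 1/4]\<close>, so its
sign at \<open>0\<close> and at \<open>x1\<close> decides.\<close>

lemma linear_two_point_interpolate:
  assumes y: "1 / 2 \<le> y" "y \<le> 1" and x: "0 \<le> x" "x \<le> x1" "x1 \<le> 1 / 4"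
    and far: "2 * mid_profile ((x1 + y) / 2) \<le> entropy_profile x1 + (y - x1 + (sqrt 2 - 1) * cap_profile y)"
  shows "2 * mid_profile ((x + y) / 2) \<le> entropy_profile x + (y - x + (sqrt 2 - 1) * cap_profile y)"
proof -
  define q where "q = mid_curv"
  have q: "17231 / 10000 < q" "q < 17232 / 10000" using mid_curv_bounds by (simp_all add: q_def)
  have F: "entropy_profile x + (y - x + (sqrt 2 - 1) * cap_profile y) - 2 * mid_profile ((x + y) / 2)
    = 1 * entropy_profile x + (q / 2 * x\<^sup>2 + (- 1 - 31 / 200 - q * (1 - y)) * x
      + ((sqrt 2 - 1) * cap_profile y + y - 1 + 31 / 200 * (1 - y) + q / 2 * (1 - y)\<^sup>2))" for x
    unfolding mid_profile_double q_def[symmetric] by (simp add: poly_simps)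
  have "0 \<le> 1 * entropy_profile x + (q / 2 * x\<^sup>2 + (- 1 - 31 / 200 - q * (1 - y)) * x
      + ((sqrt 2 - 1) * cap_profile y + y - 1 + 31 / 200 * (1 - y) + q / 2 * (1 - y)\<^sup>2))"
  proof (rule concave_on_Icc_nonneg[OF entropy_profile_concave_Icc[OF order.refl x(3)] x(1,2)])
    show "0 \<le> 1 * entropy_profile 0 + (q / 2 * 0\<^sup>2 + (- 1 - 31 / 200 - q * (1 - y)) * 0
      + ((sqrt 2 - 1) * cap_profile y + y - 1 + 31 / 200 * (1 - y) + q / 2 * (1 - y)\<^sup>2))"
      using linear_two_point_0[OF y] unfolding F[symmetric] by simp
    show "0 \<le> 1 * entropy_profile x1 + (q / 2 * x1\<^sup>2 + (- 1 - 31 / 200 - q * (1 - y)) * x1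
      + ((sqrt 2 - 1) * cap_profile y + y - 1 + 31 / 200 * (1 - y) + q / 2 * (1 - y)\<^sup>2))"
      using far unfolding F[symmetric] by simp
  qed (use q in simp_all)
  then show ?thesis unfolding F[symmetric] by simp
qed

text \<open>The far end point of the interpolation is \<open>1/16\<close>, \<open>1/8\<close>, \<open>1/4\<close> or \<open>1 - y\<close>, depending on \<open>y\<close>.\<close>

lemma entropy_cap_two_point_linear:
  assumes "1 / 2 \<le> y" "y \<le> 1" "0 \<le> x" "x \<le> 1 / 4" "x + y \<le> 1"
    and "x \<le> 1 / 16 \<or> (x \<le> 1 / 8 \<and> 16 / 25 \<le> y) \<or> 7 / 10 \<le> y"
  shows "2 * mid_profile ((x + y) / 2) \<le> entropy_profile x + (y - x + (sqrt 2 - 1) * cap_profile y)"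
proof -
  have scaled: "41421 / 100000 * w \<le> (sqrt 2 - 1) * cap_profile y"
    if "w \<le> cap_profile y" for w
  proof -
    have "41421 / 100000 * w \<le> 41421 / 100000 * cap_profile y" using that by simp
    also have "\<dots> \<le> (sqrt 2 - 1) * cap_profile y"
      using sqrt2_bounds cap_profile_nonneg assms by (intro mult_right_mono) simp_all
    finally show ?thesis .
  qed
  have curv: "17231 / 20000 * g\<^sup>2 \<le> mid_curv / 2 * g\<^sup>2" for g :: real
    using mid_curv_bounds by (intro mult_right_mono) simp_all
  consider "x \<le> 1 / 16" "y \<le> 16 / 25" | "x \<le> 1 / 8" "16 / 25 \<le> y" "y \<le> 7 / 10"
    | "7 / 10 \<le> y" "y \<le> 3 / 4" | "3 / 4 \<le> y" using assms by linarith
  then show ?thesis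
  proof cases
    case 1
    define v where "v = y - 1 / 2"
    have v: "0 \<le> v" "y = 1 / 2 + v" using assms by (simp_all add: v_def)
    have "0 \<le> v * (sqrt 2 - 141421 / 100000)" "0 \<le> v\<^sup>2 * (562 / 100 - 393 / 100 * sqrt 2)"
      using v sqrt2_bounds by (intro mult_nonneg_nonneg; simp)+
    then have "2 * mid_profile ((1 / 16 + y) / 2)
        \<le> entropy_profile (1 / 16) + (y - 1 / 16 + (sqrt 2 - 1) * cap_profile y)"
      unfolding cap_profile_le[OF 1(2)] mid_profile_double mid_curv_def entropy_profile_values unfolding v(2)
      using sqrt2_bounds v(1) by (simp add: poly_simps)
    then show ?thesis
      by (rule linear_two_point_interpolate[rotated -1]) (use assms 1 in simp_all)
  next
    case 2
    have "0 \<le> 1 * cap_profile y + (0 * y\<^sup>2 + 51 / 100 * y + (- (51 / 100) * (16 / 25) - 48387 / 100000))"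
      by (rule concave_on_Icc_nonneg[OF cap_profile_concave_Icc[of "16 / 25" "7 / 10"]])
        (use 2 cap_profile_points in simp_all)
    then have "48387 / 100000 - 51 / 100 * (y - 16 / 25) \<le> cap_profile y" by (simp add: poly_simps)
    moreover have "0 \<le> (y - 67 / 100)\<^sup>2" by simp
    ultimately have "2 * mid_profile ((1 / 8 + y) / 2)
        \<le> entropy_profile (1 / 8) + (y - 1 / 8 + (sqrt 2 - 1) * cap_profile y)"
      using scaled[of "48387 / 100000 - 51 / 100 * (y - 16 / 25)"] curv[of "1 - 1 / 8 - y"] sqrt3_bounds 2
      unfolding mid_profile_double entropy_profile_values by (simp add: poly_simps)
    then show ?thesis
      by (rule linear_two_point_interpolate[rotated -1]) (use assms 2 in simp_all)
  next
    case 3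
    have "0 \<le> 1 * cap_profile y + (0 * y\<^sup>2 + 7478 / 10000 * y + (- (7478 / 10000) * (7 / 10) - 4533 / 10000))"
      by (rule concave_on_Icc_nonneg[OF cap_profile_concave_Icc[of "7 / 10" "3 / 4"]])
        (use 3 cap_profile_points in simp_all)
    then have "4533 / 10000 - 7478 / 10000 * (y - 7 / 10) \<le> cap_profile y" by (simp add: poly_simps)
    moreover have "0 \<le> (y - 7 / 10)\<^sup>2" by simp
    ultimately have "2 * mid_profile ((1 / 4 + y) / 2)
        \<le> entropy_profile (1 / 4) + (y - 1 / 4 + (sqrt 2 - 1) * cap_profile y)"
      using scaled[of "4533 / 10000 - 7478 / 10000 * (y - 7 / 10)"] curv[of "1 - 1 / 4 - y"] sqrt2_bounds 3
      unfolding mid_profile_double entropy_profile_values by (simp add: poly_simps)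
    then show ?thesis
      by (rule linear_two_point_interpolate[rotated -1]) (use assms 3 in simp_all)
  next
    case 4
    have "sqrt (1 - y) \<le> 1 / 2" using 4 by (intro real_le_lsqrt) (simp_all add: power2_eq_square)
    then have "(1 - y) * (24461 / 7500 - 43141 / 13500 * (1 / 2)) \<le> cap_profile y"
      using 4 assms by (intro cap_profile_tail_ge) simp_all
    from scaled[OF this] have J: "68 / 100 * (1 - y) \<le> (sqrt 2 - 1) * cap_profile y" using assms by (simp add: poly_simps)
    have "log 2 (1 / (1 / 4 :: real)) = 2" using log_pow_cancel[of 2 2] by simp
    then have "sqrt 2 * (1 - y) \<le> entropy_profile (1 - y)"
      using entropy_profile_ge_linear[of "1 - y" "1 / 4"] 4 assms by simp
    moreover have "141421 / 100000 * (1 - y) \<le> sqrt 2 * (1 - y)"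
      using sqrt2_bounds assms by (intro mult_right_mono) simp_all
    ultimately have "2 * mid_profile ((1 - y + y) / 2)
        \<le> entropy_profile (1 - y) + (y - (1 - y) + (sqrt 2 - 1) * cap_profile y)"
      using J assms unfolding mid_profile_double by (simp add: poly_simps)
    then show ?thesis
      by (rule linear_two_point_interpolate[rotated -1]) (use assms 4 in simp_all)
  qed
qed

section \<open>The Bellman function and the isoperimetric inequality\<close>

text \<open>The neighbouring formulas agree at \<open>1/4\<close> and at \<open>1/2\<close>.\<close>

definition bellman :: "real \<Rightarrow> real" where
  "bellman x = (if x \<le> 1 / 4 then entropy_profile x else if x \<le> 1 / 2 then mid_profile x else cap_profile x)"

lemma bellman_small: "x \<le> 1 / 4 \<Longrightarrow> bellman x = entropy_profile x"
  by (simp add: bellman_def)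

lemma bellman_mid: "1 / 4 \<le> x \<Longrightarrow> x \<le> 1 / 2 \<Longrightarrow> bellman x = mid_profile x"
  by (cases "x = 1 / 4"; simp only: bellman_def entropy_profile_values mid_profile_values; simp)

lemma bellman_large: "1 / 2 \<le> x \<Longrightarrow> bellman x = cap_profile x"
  by (cases "x = 1 / 2"; simp only: bellman_def cap_profile_values mid_profile_values; simp)

lemma entropy_profile_le_bellman: "0 \<le> x \<Longrightarrow> x \<le> 1 / 2 \<Longrightarrow> entropy_profile x \<le> bellman x"
  by (cases "x \<le> 1 / 4") (simp_all add: bellman_small bellman_mid entropy_profile_le_mid_profile)

lemma bellman_nonneg: "0 \<le> x \<Longrightarrow> x \<le> 1 \<Longrightarrow> 0 \<le> bellman x"
  using entropy_profile_le_bellman[of x] entropy_profile_nonneg[of x] cap_profile_nonneg[of x]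
  by (cases "x \<le> 1 / 2") (simp_all add: bellman_large)

lemma bellman_two_point_low:
  assumes "0 \<le> x" "x \<le> y" "y \<le> 1 / 2"
  shows "2 * bellman ((x + y) / 2) \<le> bellman x + sqrt ((y - x)\<^sup>2 + (bellman y)\<^sup>2)"
proof (cases "(x + y) / 2 \<le> 1 / 4")
  case True
  have "(entropy_profile y)\<^sup>2 \<le> (bellman y)\<^sup>2"
    using assms by (intro power_mono entropy_profile_le_bellman entropy_profile_nonneg) simp_all
  then have "sqrt ((y - x)\<^sup>2 + (entropy_profile y)\<^sup>2) \<le> sqrt ((y - x)\<^sup>2 + (bellman y)\<^sup>2)" by simp
  moreover have "2 * entropy_profile ((x + y) / 2) \<le> entropy_profile x + sqrt ((y - x)\<^sup>2 + (entropy_profile y)\<^sup>2)"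
    using assms by (rule entropy_profile_two_point)
  moreover have "bellman x = entropy_profile x" using True assms by (intro bellman_small) simp
  ultimately show ?thesis unfolding bellman_small[OF True] by linarith
next
  case False
  then have z: "bellman ((x + y) / 2) = mid_profile ((x + y) / 2)" and y: "bellman y = mid_profile y"
    using assms by (intro bellman_mid; simp)+
  consider "x \<le> 1 / 8" | "1 / 8 \<le> x" "x \<le> 1 / 4" | "1 / 4 \<le> x" by linarith
  then show ?thesis
  proof cases
    case 1
    then show ?thesis
      using mid_profile_two_point_small[of x y] assms False unfolding z y by (simp add: bellman_small)
  next
    case 2
    then show ?thesis
      using mid_profile_two_point[of x y] mid_profile_le_entropy_profile[of x] assms
      unfolding z y by (simp add: bellman_small)
  next
    case 3
    then show ?thesis
      using mid_profile_two_point[of x y] assms unfolding z y by (simp add: bellman_mid)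
  qed
qed

lemma bellman_two_point_middle:
  assumes "0 \<le> x" "1 / 2 \<le> y" "x + y \<le> 1"
  shows "2 * bellman ((x + y) / 2)
    \<le> bellman x + max (sqrt ((y - x)\<^sup>2 + (bellman y)\<^sup>2)) (y - x + (sqrt 2 - 1) * bellman y)"
proof -
  have z: "bellman ((x + y) / 2) = mid_profile ((x + y) / 2)"
    using assms by (intro bellman_mid) simp_all
  have y: "bellman y = cap_profile y" using assms by (intro bellman_large)
  show ?thesis
  proof (cases "x \<le> 1 / 4")
    case True
    show ?thesis
    proof (cases "x \<le> 1 / 16 \<or> (x \<le> 1 / 8 \<and> 16 / 25 \<le> y) \<or> 7 / 10 \<le> y")
      case lin: True
      have "2 * mid_profile ((x + y) / 2) \<le> entropy_profile x + (y - x + (sqrt 2 - 1) * cap_profile y)"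
        using assms True lin by (intro entropy_cap_two_point_linear) simp_all
      then show ?thesis unfolding z y bellman_small[OF True] by linarith
    next
      case False
      have "2 * mid_profile ((x + y) / 2) \<le> entropy_profile x + sqrt ((y - x)\<^sup>2 + (cap_profile y)\<^sup>2)"
      proof (rule entropy_cap_two_point_euclidean)
        show "y \<le> 16 / 25 \<or> (1 / 8 \<le> x \<and> y \<le> 7 / 10) \<or> (x = 1 / 4 \<and> y \<le> 3 / 4)" using False by linarith
      qed (use assms True False in simp_all)
      then show ?thesis unfolding z y bellman_small[OF True] by linarith
    qed
  next
    case False
    then have "bellman x = mid_profile x" using assms by (intro bellman_mid) simp_all
    moreover have "2 * mid_profile ((x + y) / 2) \<le> mid_profile x + sqrt ((y - x)\<^sup>2 + (cap_profile y)\<^sup>2)"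
      using False assms by (intro mid_cap_two_point) simp_all
    ultimately show ?thesis unfolding z y by simp
  qed
qed

lemma bellman_antidiagonal:
  assumes "0 \<le> x" "x \<le> 1 / 2"
  shows "1 \<le> bellman x + sqrt ((1 - 2 * x)\<^sup>2 + (cap_profile (1 - x))\<^sup>2)"
  using antidiagonal_entropy[of x] antidiagonal_mid[of x] assms
  by (cases "x \<le> 1 / 4") (simp_all add: bellman_small bellman_mid)

lemma bellman_two_point_high:
  assumes "0 \<le> x" "x \<le> y" "y \<le> 1" "1 / 2 \<le> y" "1 \<le> x + y"
  shows "2 * bellman ((x + y) / 2) \<le> bellman x + sqrt ((y - x)\<^sup>2 + (bellman y)\<^sup>2)"
proof -
  have z: "bellman ((x + y) / 2) = cap_profile ((x + y) / 2)"
    using assms by (intro bellman_large) simp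
  have y: "bellman y = cap_profile y" using assms by (intro bellman_large)
  show ?thesis
  proof (cases "x \<le> 1 / 2")
    case True
    have "1 - 2 * x \<le> bellman x + sqrt ((1 - 2 * x)\<^sup>2 + (cap_profile (1 - x))\<^sup>2) - 2 * x"
      using bellman_antidiagonal[of x] assms True by simp
    moreover have "sqrt ((1 - x - x)\<^sup>2 + (cap_profile (1 - x))\<^sup>2) - 2 * cap_profile ((x + (1 - x)) / 2)
        \<le> sqrt ((y - x)\<^sup>2 + (cap_profile y)\<^sup>2) - 2 * cap_profile ((x + y) / 2)"
      using assms True by (intro cap_gap_mono) simp_all
    moreover have "1 - x - x = 1 - 2 * x" "(x + (1 - x)) / 2 = 1 / 2" by simp_all
    ultimately show ?thesis unfolding z y by (simp add: cap_profile_values)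
  next
    case False
    have "sqrt ((x - x)\<^sup>2 + (cap_profile x)\<^sup>2) - 2 * cap_profile ((x + x) / 2)
        \<le> sqrt ((y - x)\<^sup>2 + (cap_profile y)\<^sup>2) - 2 * cap_profile ((x + y) / 2)"
      using assms False by (intro cap_gap_mono) simp_all
    moreover have "0 \<le> cap_profile x" using False assms by (intro cap_profile_nonneg) simp_all
    moreover have "bellman x = cap_profile x" using False by (intro bellman_large) simp
    ultimately show ?thesis unfolding z y by simp
  qed
qed

theorem two_point_subsolution_bellman: "two_point_subsolution bellman"
  unfolding two_point_subsolution_def
proof (intro allI impI)
  fix x y :: real assume xy: "0 \<le> x" "x \<le> y" "y \<le> 1"
  consider "y \<le> 1 / 2" | "1 / 2 \<le> y" "x + y \<le> 1" | "1 / 2 \<le> y" "1 \<le> x + y" by linarith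
  then show "2 * bellman ((x + y) / 2)
    \<le> bellman x + max (sqrt ((y - x)\<^sup>2 + (bellman y)\<^sup>2)) (y - x + (sqrt 2 - 1) * bellman y)"
  proof cases
    case 1
    then show ?thesis using bellman_two_point_low[of x y] xy by linarith
  next
    case 2
    then show ?thesis using bellman_two_point_middle[of x y] xy by blast
  next
    case 3
    then show ?thesis using bellman_two_point_high[of x y] xy by linarith
  qed
qed

theorem theorem1p1:
  fixes n :: nat and A :: "bool list set"
  assumes "n \<ge> 1"
    and "A \<subseteq> cube n"
    and "cube_measure n A \<le> 1 / 2"
  shows "cube_expectation n (\<lambda>x. sqrt (real (edge_boundary n A x)))
       \<ge> cube_measure n A * sqrt (log 2 (1 / cube_measure n A))"
proof -
  have "cube_measure n A * sqrt (log 2 (1 / cube_measure n A)) = entropy_profile (cube_measure n A)"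
    by (simp add: entropy_profile_def)
  also have "\<dots> \<le> bellman (cube_measure n A)"
    using assms(3) by (intro entropy_profile_le_bellman cube_measure_nonneg)
  also have "\<dots> \<le> cube_expectation n (\<lambda>x. sqrt (real (edge_boundary n A x)))"
    using assms(2)
    by (intro expectation_sqrt_boundary_ge_subsolution two_point_subsolution_bellman bellman_nonneg)
      (simp_all add: bellman_small bellman_large cap_profile_values)
  finally show ?thesis .
qed

end
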